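(* For all $m\geq 0$ and $n\geq 0$, the chromatic symmetric function $X_{L_{m,n}}$ is $e$-positive, and hence Schur-positive.
   Context: All graphs are finite and simple. For a graph $G$ with vertex set $\{v_1,\dots,v_N\}$, the chromatic symmetric function is $X_G=\sum_\kappa x_{\kappa(v_1)}\cdots x_{\kappa(v_N)}$, summed over all proper colourings $\kappa:V\to\{1,2,\dots\}$; $X_\emptyset=1$. $K_m$ is the complete graph on $m$ vertices, $P_n$ the path on $n$ vertices. For $m,n\geq1$ the lollipop graph $L_{m,n}$ is obtained from the disjoint union of $K_m$ and $P_n$ by adding an edge joining a vertex of $K_m$ to an end vertex of $P_n$; conventions $K_0=P_0=L_{0,0}=\emptyset$, $L_{m,0}=K_m$, $L_{0,n}=P_n$. For a partition $\lambda=(\lambda_1,\dots,\lambda_\ell)$, $e_\lambda=e_{\lambda_1}\cdots e_{\lambda_\ell}$ where $e_i$ is the $i$-th elementary symmetric function. A symmetric function is $e$-positive if it is a nonnegative linear combination of the $e_\lambda$, and Schur-positive if it is a nonnegative linear combination of Schur functions $s_\lambda$. *)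

theory Defs
  imports Complex_Main "HOL-Library.Multiset" "HOL-Library.FuncSet"
begin

section \<open>Formal power series in countably many variables\<close>

text \<open>
  The variables are indexed by \<^typ>\<open>nat\<close>, with the index \<open>i\<close> standing for \<open>x\<^sub>i\<^sub>+\<^sub>1\<close> (so colours and
  tableau entries start at \<open>0\<close> instead of \<open>1\<close>). A monomial is the multiset of the indices of its
  variables, and a series is its coefficient function.
\<close>

type_synonym series = "nat multiset \<Rightarrow> rat"

text \<open>
  The formal sum of the monomials \<open>w s\<close> over all \<open>s \<in> S\<close>. It is meaningful only if every
  monomial occurs finitely often; this is proved below for each use.
\<close>

definition monomial_sum :: "'s set \<Rightarrow> ('s \<Rightarrow> nat multiset) \<Rightarrow> series" where
  "monomial_sum S w = (\<lambda>M. of_nat (card {s \<in> S. w s = M}))"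

definition series_one :: series where
  "series_one = (\<lambda>M. if M = {#} then 1 else 0)"

definition series_mult :: "series \<Rightarrow> series \<Rightarrow> series" where
  "series_mult f g = (\<lambda>M. \<Sum>A\<in>{A. A \<subseteq># M}. f A * g (M - A))"

lemma finite_submultisets: "finite {A. A \<subseteq># (M :: nat multiset)}"
proof (rule finite_subset)
  let ?L = "{xs. set xs \<subseteq> set_mset M \<and> length xs \<le> size M}"
  show "{A. A \<subseteq># M} \<subseteq> mset ` ?L"
  proof
    fix A assume "A \<in> {A. A \<subseteq># M}"
    moreover obtain xs where "mset xs = A" using ex_mset by blast
    ultimately show "A \<in> mset ` ?L"
      by (auto simp flip: size_mset dest: size_mset_mono mset_subset_eqD intro!: image_eqI[of _ _ xs])
  qed
qed (simp add: finite_lists_length_le)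

section \<open>Elementary and Schur functions\<close>

definition is_partition :: "nat list \<Rightarrow> bool" where
  "is_partition p \<longleftrightarrow> sorted_wrt (\<ge>) p \<and> 0 \<notin> set p"

definition elementary :: "nat \<Rightarrow> series" where
  "elementary k = monomial_sum {A. finite A \<and> card A = k} mset_set"

definition elementary_partition :: "nat list \<Rightarrow> series" where
  "elementary_partition p = foldr (\<lambda>k f. series_mult (elementary k) f) p series_one"

text \<open>Cells are in English notation: \<open>(i, j)\<close> lies in row \<open>i\<close> and column \<open>j\<close>, counted from \<open>0\<close>.\<close>

definition young_diagram :: "nat list \<Rightarrow> (nat \<times> nat) set" where
  "young_diagram p = {(i, j). i < length p \<and> j < p ! i}"

definition semistandard_tableaux :: "nat list \<Rightarrow> (nat \<times> nat \<Rightarrow> nat) set" where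
  "semistandard_tableaux p = {T \<in> young_diagram p \<rightarrow>\<^sub>E UNIV.
     (\<forall>i j. (i, j) \<in> young_diagram p \<and> (i, Suc j) \<in> young_diagram p \<longrightarrow> T (i, j) \<le> T (i, Suc j)) \<and>
     (\<forall>i j. (i, j) \<in> young_diagram p \<and> (Suc i, j) \<in> young_diagram p \<longrightarrow> T (i, j) < T (Suc i, j))}"

definition schur :: "nat list \<Rightarrow> series" where
  "schur p = monomial_sum (semistandard_tableaux p)
     (\<lambda>T. image_mset T (mset_set (young_diagram p)))"

definition nonneg_combination :: "(nat list \<Rightarrow> series) \<Rightarrow> series \<Rightarrow> bool" where
  "nonneg_combination b f \<longleftrightarrow>
     (\<exists>P c. finite P \<and> (\<forall>p\<in>P. is_partition p \<and> 0 \<le> c p) \<and> f = (\<lambda>M. \<Sum>p\<in>P. c p * b p M))"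

definition e_positive :: "series \<Rightarrow> bool" where
  "e_positive = nonneg_combination elementary_partition"

definition schur_positive :: "series \<Rightarrow> bool" where
  "schur_positive = nonneg_combination schur"

section \<open>Graphs and the chromatic symmetric function\<close>

text \<open>A graph is a pair of a vertex set and a set of edges, each edge being a set of two vertices.\<close>

type_synonym 'v graph = "'v set \<times> 'v set set"

definition simple_graph :: "'v graph \<Rightarrow> bool" where
  "simple_graph G \<longleftrightarrow> finite (fst G) \<and> (\<forall>e\<in>snd G. e \<subseteq> fst G \<and> card e = 2)"

definition proper_colourings :: "'v graph \<Rightarrow> ('v \<Rightarrow> nat) set" where
  "proper_colourings G = {\<kappa> \<in> fst G \<rightarrow>\<^sub>E UNIV. \<forall>u v. {u, v} \<in> snd G \<longrightarrow> \<kappa> u \<noteq> \<kappa> v}"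

definition chromatic_symmetric_function :: "'v graph \<Rightarrow> series" where
  "chromatic_symmetric_function G =
     monomial_sum (proper_colourings G) (\<lambda>\<kappa>. image_mset \<kappa> (mset_set (fst G)))"

definition complete_graph :: "nat \<Rightarrow> nat graph" where
  "complete_graph m = ({..<m}, {{i, j} | i j. i < m \<and> j < m \<and> i \<noteq> j})"

definition path_graph :: "nat \<Rightarrow> nat graph" where
  "path_graph n = ({..<n}, {{i, Suc i} | i. Suc i < n})"

definition disjoint_union :: "'u graph \<Rightarrow> 'v graph \<Rightarrow> ('u + 'v) graph" where
  "disjoint_union G H = (fst G <+> fst H, (`) Inl ` snd G \<union> (`) Inr ` snd H)"

text \<open>
  For \<open>m = 0\<close> or \<open>n = 0\<close> no edge is added, so that these cases are \<open>P\<^sub>n\<close> and \<open>K\<^sub>m\<close> (with relabelled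
  vertices).
\<close>

definition lollipop :: "nat \<Rightarrow> nat \<Rightarrow> (nat + nat) graph" where
  "lollipop m n = (let G = disjoint_union (complete_graph m) (path_graph n)
     in (fst G, snd G \<union> (if 1 \<le> m \<and> 1 \<le> n then {{Inl 0, Inr 0}} else {})))"

lemma simple_graph_lollipop: "simple_graph (lollipop m n)"
  by (auto simp: simple_graph_def lollipop_def disjoint_union_def complete_graph_def
      path_graph_def Let_def card_image card_insert_if)

section \<open>Every monomial occurs finitely often\<close>

lemma finite_filling_fibre:
  assumes "finite D"
  shows "finite {T \<in> D \<rightarrow>\<^sub>E UNIV. image_mset T (mset_set D) = M}"
proof (rule finite_subset)
  show "{T \<in> D \<rightarrow>\<^sub>E UNIV. image_mset T (mset_set D) = M} \<subseteq> D \<rightarrow>\<^sub>E set_mset M"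
    using assms by (auto simp: PiE_iff extensional_def)
qed (use assms in \<open>auto intro: finite_PiE\<close>)

lemma finite_young_diagram: "finite (young_diagram p)"
proof -
  have "young_diagram p = (SIGMA i:{..<length p}. {..<p ! i})"
    by (auto simp: young_diagram_def)
  then show ?thesis by simp
qed

lemma finite_colouring_fibre:
  assumes "finite (fst G)"
  shows "finite {\<kappa> \<in> proper_colourings G. image_mset \<kappa> (mset_set (fst G)) = M}"
  by (rule finite_subset[OF _ finite_filling_fibre[OF assms, of M]])
    (auto simp: proper_colourings_def)

lemma finite_tableau_fibre:
  "finite {T \<in> semistandard_tableaux p. image_mset T (mset_set (young_diagram p)) = M}"
  by (rule finite_subset[OF _ finite_filling_fibre[OF finite_young_diagram, of p M]])
    (auto simp: semistandard_tableaux_def)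

lemma finite_subset_fibre: "finite {A :: nat set. (finite A \<and> card A = k) \<and> mset_set A = M}"
  by (rule finite_subset[of _ "{set_mset M}"]) auto

end

(*
  A colouring of the disjoint union of K_m and P_(n+1) either avoids all colours of K_m at the first
  path vertex, or repeats exactly one of them there. Counting both kinds gives, for m > 0,
    m X(L_(m,n+1)) = (m - 1) X(K_m) X(P_(n+1)) + X(L_(m+1,n)),
  and since X(K_m) = m! e_m and P_(n+1) = L_(1,n), e-positivity follows by induction on n.

  Schur positivity of the e_lambda follows from the Pieri rule e_k s_mu = sum of the s_lambda with
  lambda / mu a vertical k-strip. Removing the largest entry of a tableau removes a horizontal strip,
  so by induction on the monomial the rule reduces to an exchange of horizontal and vertical strips
  between two fixed shapes.
*)

theory Submission imports Defs begin

section \<open>Products of series\<close>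

text \<open>The recurrence preserves e-positivity because its coefficients \<open>m - 1\<close> and
  1 are nonnegative, rational scalars allow division by m, and multiplication by m! e_m only inserts
  one part into each partition. The Pieri rule is treated as an identity of coefficients: for each
  multiset M it compares numbers of tableaux. Write U_k for adding vertical k-strips and D_c for
  removing horizontal c-strips. A set of k variables either avoids the largest entry of M or uses up
  one of its copies, and this dichotomy turns the induction step into the relation D_(c+1) U_k = U_k
  D_(c+1) + U_(k-1) D_c. Instead of an insertion bijection on tableaux, the intermediate shapes
  between two fixed end shapes are counted: their rows can be chosen independently, so the counts
  are binomial coefficients. Shapes are functions that end in zeros rather than lists, since a
  vertical strip may create new rows.\<close>

lemma series_mult_monomial_sum:
  assumes S: "\<And>M. finite {s \<in> S. w s = M}" and T: "\<And>M. finite {t \<in> T. v t = M}"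
  shows "series_mult (monomial_sum S w) (monomial_sum T v)
       = monomial_sum (S \<times> T) (\<lambda>(s, t). w s + v t)"
proof
  fix M
  let ?F = "\<lambda>A. {s \<in> S. w s = A} \<times> {t \<in> T. v t = M - A}"
  have "{x \<in> S \<times> T. (\<lambda>(s, t). w s + v t) x = M} = (\<Union>A\<in>{A. A \<subseteq># M}. ?F A)"
    by (auto simp: subset_mset.add_diff_inverse)
  moreover have "card (\<Union>A\<in>{A. A \<subseteq># M}. ?F A) = (\<Sum>A\<in>{A. A \<subseteq># M}. card (?F A))"
    by (rule card_UN_disjoint) (auto simp: finite_submultisets S T)
  ultimately show "series_mult (monomial_sum S w) (monomial_sum T v) M
      = monomial_sum (S \<times> T) (\<lambda>(s, t). w s + v t) M"
    by (simp add: series_mult_def monomial_sum_def card_cartesian_product)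
qed

lemma monomial_sum_bij_betw:
  assumes "bij_betw h S T" and "\<And>s. s \<in> S \<Longrightarrow> v (h s) = w s"
  shows "monomial_sum S w = monomial_sum T v"
proof
  fix M
  have "bij_betw h {s \<in> S. w s = M} {t \<in> T. v t = M}"
    using assms by (fastforce simp: bij_betw_def inj_on_def)
  then show "monomial_sum S w M = monomial_sum T v M"
    by (simp add: monomial_sum_def bij_betw_same_card)
qed

text \<open>\<open>mset_set (set_mset M) = M\<close> says that the monomial is squarefree; such a
  monomial comes from exactly one set, its support.\<close>

lemma elementary_eq:
  "elementary k M = (if mset_set (set_mset M) = M \<and> card (set_mset M) = k then 1 else 0)"
proof -
  have "mset_set A = M \<longleftrightarrow> mset_set (set_mset M) = M \<and> A = set_mset M" if "finite A" for A
    using that by (metis finite_set_mset_mset_set)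
  then have "{A. (finite A \<and> card A = k) \<and> mset_set A = M}
      = {A. (mset_set (set_mset M) = M \<and> card (set_mset M) = k) \<and> A = set_mset M}"
    by (metis (no_types, opaque_lifting) finite_set_mset)
  then show ?thesis
    by (simp add: elementary_def monomial_sum_def)
qed

text \<open>Only squarefree submultisets contribute to the product, and these correspond to subsets
  of the support. This is the form in which the Pieri rule is counted.\<close>

lemma series_mult_elementary:
  "series_mult (elementary k) f M
     = (\<Sum>A\<in>{A. A \<subseteq> set_mset M \<and> card A = k}. f (M - mset_set A))"
proof -
  let ?S = "{A. A \<subseteq> set_mset M \<and> card A = k}"
  have fin: "A \<subseteq> set_mset M \<Longrightarrow> finite A" for A
    by (auto intro: finite_subset)
  have "(\<Sum>A\<in>?S. f (M - mset_set A)) = (\<Sum>B\<in>mset_set ` ?S. elementary k B * f (M - B))"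
  proof (subst sum.reindex)
    show "inj_on mset_set ?S"
      by (rule inj_on_inverseI[of _ set_mset]) (simp add: fin)
  qed (simp add: elementary_eq fin)
  also have "\<dots> = series_mult (elementary k) f M"
    unfolding series_mult_def
  proof (rule sum.mono_neutral_left)
    show "mset_set ` ?S \<subseteq> {A. A \<subseteq># M}"
      by (auto simp: fin subseteq_mset_def count_mset_set' Suc_le_eq)
    show "\<forall>B\<in>{A. A \<subseteq># M} - mset_set ` ?S. elementary k B * f (M - B) = 0"
    proof
      fix B assume B: "B \<in> {A. A \<subseteq># M} - mset_set ` ?S"
      have "B \<in> mset_set ` ?S" if "mset_set (set_mset B) = B" "card (set_mset B) = k"
        using that B by (intro image_eqI[of _ _ "set_mset B"]) (simp_all add: set_mset_mono)
      then show "elementary k B * f (M - B) = 0"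
        using B by (auto simp: elementary_eq)
    qed
  qed (simp add: finite_submultisets)
  finally show ?thesis by simp
qed

lemma add_subseteq_mset_iff: "A + B \<subseteq># M \<longleftrightarrow> A \<subseteq># M \<and> B \<subseteq># M - A"
proof -
  have "A \<subseteq># M" if "A + B \<subseteq># M"
    using that mset_subset_eq_add_left subset_mset.dual_order.trans by blast
  then show ?thesis
    by (metis add.commute subset_mset.le_diff_conv2)
qed

text \<open>A twofold product is a sum over pairs \<open>(A, B)\<close> with
  \<open>A + B \<subseteq># M\<close>, in which the two outer factors have symmetric roles. The law
  serves to sort the factors of an \<open>elementary_partition\<close>.\<close>

lemma series_mult_elementary_left_commute:
  "series_mult (elementary j) (series_mult (elementary k) f)
     = series_mult (elementary k) (series_mult (elementary j) f)"
proof -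
  have *: "series_mult f (series_mult g h) M
      = (\<Sum>(A, B)\<in>{(A, B). A + B \<subseteq># M}. f A * g B * h (M - (A + B)))" for f g h M
  proof -
    have *: "{(A, B). A + B \<subseteq># M} = (SIGMA A:{A. A \<subseteq># M}. {B. B \<subseteq># M - A})"
      by (auto simp: add_subseteq_mset_iff)
    show ?thesis
      unfolding * series_mult_def sum_distrib_left
      by (subst sum.Sigma) (simp_all add: finite_submultisets mult.assoc)
  qed
  show ?thesis
  proof
    fix M
    show "series_mult (elementary j) (series_mult (elementary k) f) M
      = series_mult (elementary k) (series_mult (elementary j) f) M"
      unfolding *
      by (rule sum.reindex_bij_witness[of _ prod.swap prod.swap]) (auto simp: ac_simps)
  qed
qed

section \<open>Nonnegative combinations\<close>

lemma nonneg_combination_basis: "is_partition p \<Longrightarrow> nonneg_combination b (b p)"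
  unfolding nonneg_combination_def by (intro exI[of _ "{p}"] exI[of _ "\<lambda>_. 1"]) simp

lemma nonneg_combination_zero: "nonneg_combination b (\<lambda>M. 0)"
  unfolding nonneg_combination_def by (intro exI[of _ "{}"]) simp

lemma nonneg_combination_scale:
  assumes "nonneg_combination b f" and "0 \<le> a"
  shows "nonneg_combination b (\<lambda>M. a * f M)"
proof -
  obtain P c where "finite P" "\<forall>p\<in>P. is_partition p \<and> 0 \<le> c p" "f = (\<lambda>M. \<Sum>p\<in>P. c p * b p M)"
    using assms(1) unfolding nonneg_combination_def by blast
  then show ?thesis
    using assms(2) unfolding nonneg_combination_def
    by (intro exI[of _ P] exI[of _ "\<lambda>p. a * c p"]) (simp add: sum_distrib_left mult.assoc)
qed

lemma nonneg_combination_add: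
  assumes "nonneg_combination b f" and "nonneg_combination b g"
  shows "nonneg_combination b (\<lambda>M. f M + g M)"
proof -
  obtain P c where P: "finite P" "\<forall>p\<in>P. is_partition p \<and> 0 \<le> c p" "f = (\<lambda>M. \<Sum>p\<in>P. c p * b p M)"
    using assms(1) unfolding nonneg_combination_def by blast
  obtain Q d where Q: "finite Q" "\<forall>p\<in>Q. is_partition p \<and> 0 \<le> d p" "g = (\<lambda>M. \<Sum>p\<in>Q. d p * b p M)"
    using assms(2) unfolding nonneg_combination_def by blast
  let ?c = "\<lambda>p. (if p \<in> P then c p else 0) + (if p \<in> Q then d p else 0)"
  have "f M + g M = (\<Sum>p\<in>P \<union> Q. ?c p * b p M)" for M
  proof -
    have "(\<Sum>p\<in>P \<union> Q. (if p \<in> P then c p else 0) * b p M) = f M"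
      unfolding P(3) by (rule sum.mono_neutral_cong_right) (auto simp: P Q)
    moreover have "(\<Sum>p\<in>P \<union> Q. (if p \<in> Q then d p else 0) * b p M) = g M"
      unfolding Q(3) by (rule sum.mono_neutral_cong_right) (auto simp: P Q)
    ultimately show ?thesis by (simp add: distrib_right sum.distrib)
  qed
  then show ?thesis
    using P Q unfolding nonneg_combination_def
    by (intro exI[of _ "P \<union> Q"] exI[of _ ?c]) auto
qed

lemma nonneg_combination_sum:
  assumes "\<And>i. i \<in> I \<Longrightarrow> nonneg_combination b (f i)"
  shows "nonneg_combination b (\<lambda>M. \<Sum>i\<in>I. f i M)"
  using assms
  by (induction I rule: infinite_finite_induct)
    (auto intro: nonneg_combination_zero nonneg_combination_add)

text \<open>Used with \<open>F\<close> the multiplication by an elementary function, for either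
  basis, and with \<open>F\<close> the identity for the passage from the e-basis to the Schur
  basis.\<close>

lemma nonneg_combination_linear_image:
  assumes "nonneg_combination b f" and "\<And>p. is_partition p \<Longrightarrow> nonneg_combination b' (F (b p))"
    and "\<And>P c. finite P \<Longrightarrow> F (\<lambda>M. \<Sum>p\<in>P. c p * b p M) = (\<lambda>M. \<Sum>p\<in>P. c p * F (b p) M)"
  shows "nonneg_combination b' (F f)"
proof -
  obtain P c where P: "finite P" "\<forall>p\<in>P. is_partition p \<and> 0 \<le> c p" "f = (\<lambda>M. \<Sum>p\<in>P. c p * b p M)"
    using assms(1) unfolding nonneg_combination_def by blast
  then show ?thesis
    unfolding P(3) assms(3)[OF P(1)]
    by (intro nonneg_combination_sum nonneg_combination_scale assms(2)) auto
qed

lemma series_mult_sum_right: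
  "series_mult g (\<lambda>M. \<Sum>p\<in>P. c p * b p M) = (\<lambda>M. \<Sum>p\<in>P. c p * series_mult g (b p) M)"
proof
  fix M
  show "series_mult g (\<lambda>M. \<Sum>p\<in>P. c p * b p M) M = (\<Sum>p\<in>P. c p * series_mult g (b p) M)"
    unfolding series_mult_def sum_distrib_left
    by (subst sum.swap) (intro sum.cong refl mult.left_commute)
qed

lemma elementary_partition_Cons:
  "elementary_partition (k # p) = series_mult (elementary k) (elementary_partition p)"
  by (simp add: elementary_partition_def)

lemma e_positive_series_mult_elementary:
  assumes "e_positive f" and "k \<noteq> 0"
  shows "e_positive (series_mult (elementary k) f)"
  using assms(1) unfolding e_positive_def
proof (rule nonneg_combination_linear_image)
  fix p assume "is_partition p"
  \<comment> \<open>Insertion sort. The bound on \<open>set q\<close> strengthens the induction: an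
    entry \<open>l > k\<close> put back in front of \<open>q\<close> must still dominate all of
    \<open>q\<close>.\<close>
  then have "\<exists>q. is_partition q \<and> set q \<subseteq> insert k (set p) \<and>
      series_mult (elementary k) (elementary_partition p) = elementary_partition q"
  proof (induction p)
    case Nil
    then show ?case using assms(2)
      by (intro exI[of _ "[k]"]) (simp add: is_partition_def elementary_partition_Cons)
  next
    case (Cons l p)
    show ?case
    proof (cases "l \<le> k")
      case True
      then show ?thesis using Cons assms(2)
        by (intro exI[of _ "k # l # p"])
          (auto simp: is_partition_def elementary_partition_Cons)
    next
      case False
      moreover obtain q where "is_partition q" "set q \<subseteq> insert k (set p)"
          "series_mult (elementary k) (elementary_partition p) = elementary_partition q"
        using Cons by (auto simp: is_partition_def)
      ultimately show ?thesis using Cons.prems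
        by (intro exI[of _ "l # q"])
          (auto simp: is_partition_def elementary_partition_Cons
            series_mult_elementary_left_commute[of k])
    qed
  qed
  then show "nonneg_combination elementary_partition
      (series_mult (elementary k) (elementary_partition p))"
    by (metis nonneg_combination_basis)
qed (rule series_mult_sum_right)

section \<open>Colourings of lollipops as pairs of lists\<close>

definition distinct_lists :: "nat \<Rightarrow> nat list set" where
  "distinct_lists m = {xs. length xs = m \<and> distinct xs}"

definition path_lists :: "nat \<Rightarrow> nat list set" where
  "path_lists n = {ys. length ys = n \<and> distinct_adj ys}"

text \<open>The heads are the colours of \<open>Inl 0\<close> and \<open>Inr 0\<close>, the ends of
  the joining edge; the guard reflects that there is no such edge if m or n is 0.\<close>

definition lollipop_lists :: "nat \<Rightarrow> nat \<Rightarrow> (nat list \<times> nat list) set" where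
  "lollipop_lists m n =
     {(xs, ys) \<in> distinct_lists m \<times> path_lists n. xs \<noteq> [] \<and> ys \<noteq> [] \<longrightarrow> hd xs \<noteq> hd ys}"

definition lollipop_series :: "nat \<Rightarrow> nat \<Rightarrow> series" where
  "lollipop_series m n = monomial_sum (lollipop_lists m n) (\<lambda>(xs, ys). mset xs + mset ys)"

lemma proper_colourings_lollipop:
  "\<kappa> \<in> proper_colourings (lollipop m n) \<longleftrightarrow> \<kappa> \<in> ({..<m} <+> {..<n}) \<rightarrow>\<^sub>E UNIV \<and>
     (\<forall>i j. i < m \<and> j < m \<and> i \<noteq> j \<longrightarrow> \<kappa> (Inl i) \<noteq> \<kappa> (Inl j)) \<and>
     (\<forall>i. Suc i < n \<longrightarrow> \<kappa> (Inr i) \<noteq> \<kappa> (Inr (Suc i))) \<and>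
     (1 \<le> m \<and> 1 \<le> n \<longrightarrow> \<kappa> (Inl 0) \<noteq> \<kappa> (Inr 0))"
proof -
  \<comment> \<open>The colour condition as a property of the unordered edge: being symmetric in the
    end points, it can be evaluated on each generating family of edges separately.\<close>
  define Q where "Q e \<longleftrightarrow> (\<forall>u v. {u, v} = e \<longrightarrow> \<kappa> u \<noteq> \<kappa> v)" for e
  have Q: "Q {u, v} \<longleftrightarrow> \<kappa> u \<noteq> \<kappa> v" for u v
    unfolding Q_def doubleton_eq_iff by auto
  have compr: "(\<forall>x. (\<exists>i j. x = f i j \<and> P i j) \<longrightarrow> R x) \<longleftrightarrow> (\<forall>i j. P i j \<longrightarrow> R (f i j))"
    "(\<forall>x. (\<exists>i. x = g i \<and> P' i) \<longrightarrow> R x) \<longleftrightarrow> (\<forall>i. P' i \<longrightarrow> R (g i))"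
    for f :: "nat \<Rightarrow> nat \<Rightarrow> nat set" and g :: "nat \<Rightarrow> nat set" and P P' R
    by blast+
  have "\<kappa> \<in> proper_colourings G \<longleftrightarrow> \<kappa> \<in> fst G \<rightarrow>\<^sub>E UNIV \<and> (\<forall>e\<in>snd G. Q e)" for G
    unfolding proper_colourings_def Q_def by blast
  then show ?thesis
    by (simp add: lollipop_def disjoint_union_def complete_graph_def
        path_graph_def Let_def ball_Un compr Q) blast
qed

lemma chromatic_symmetric_function_lollipop:
  "chromatic_symmetric_function (lollipop m n) = lollipop_series m n"
proof -
  let ?V = "{..<m} <+> {..<n}"
  have V: "fst (lollipop m n) = ?V"
    by (simp add: lollipop_def disjoint_union_def complete_graph_def path_graph_def Let_def)
  let ?h = "\<lambda>\<kappa>. (map (\<lambda>i. \<kappa> (Inl i)) [0..<m], map (\<lambda>i. \<kappa> (Inr i)) [0..<n])"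
  let ?g = "\<lambda>(xs, ys). \<lambda>v\<in>?V. case v of Inl i \<Rightarrow> xs ! i | Inr i \<Rightarrow> ys ! i"
  have "bij_betw ?h (proper_colourings (lollipop m n)) (lollipop_lists m n)"
  proof (rule bij_betwI[where g = ?g])
    show "?h \<in> proper_colourings (lollipop m n) \<rightarrow> lollipop_lists m n"
      unfolding proper_colourings_lollipop Pi_def
      by (auto simp: lollipop_lists_def distinct_lists_def path_lists_def distinct_conv_nth
          distinct_adj_conv_nth hd_map)
    show "?g \<in> lollipop_lists m n \<rightarrow> proper_colourings (lollipop m n)"
      unfolding proper_colourings_lollipop Pi_def
      by (auto simp: lollipop_lists_def distinct_lists_def path_lists_def nth_eq_iff_index_eq
          distinct_adj_conv_nth hd_conv_nth)
    show "?g (?h \<kappa>) = \<kappa>" if "\<kappa> \<in> proper_colourings (lollipop m n)" for \<kappa>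
      using that unfolding proper_colourings_lollipop
      by (auto simp: fun_eq_iff PiE_iff extensional_def restrict_def split: sum.split)
    show "?h (?g y) = y" if "y \<in> lollipop_lists m n" for y
      using that
      by (auto simp: lollipop_lists_def distinct_lists_def path_lists_def intro!: nth_equalityI)
  qed
  moreover have "(\<lambda>(xs, ys). mset xs + mset ys) (?h \<kappa>) = image_mset \<kappa> (mset_set ?V)" for \<kappa>
  proof -
    have "mset_set ?V = image_mset Inl (mset_set {..<m}) + image_mset Inr (mset_set {..<n})"
      unfolding Plus_def
      by (subst mset_set_Union) (auto simp: image_mset_mset_set)
    then show ?thesis
      by (simp add: image_mset.compositionality comp_def lessThan_atLeast0)
  qed
  ultimately show ?thesis
    unfolding chromatic_symmetric_function_def lollipop_series_def V
    by (rule monomial_sum_bij_betw)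
qed

section \<open>Cliques, paths and the recurrence in the path length\<close>

lemma finite_mset_fibre: "finite {xs \<in> X. mset xs = M}"
  by (rule finite_subset[of _ "{xs. set xs \<subseteq> set_mset M \<and> length xs = size M}"])
    (auto simp: finite_lists_length_eq)

lemma finite_mset_pair_fibre: "finite {(xs, ys). mset xs + mset ys = M}"
proof (rule finite_subset)
  let ?L = "{xs. set xs \<subseteq> set_mset M \<and> length xs \<le> size M}"
  show "{(xs, ys). mset xs + mset ys = M} \<subseteq> ?L \<times> ?L"
    by auto
qed (simp add: finite_lists_length_le)

text \<open>A squarefree monomial of degree m is the content of exactly m! injective words, and no
  other monomial is the content of one.\<close>

lemma monomial_sum_distinct_lists:
  "monomial_sum (distinct_lists m) mset = (\<lambda>M. fact m * elementary m M)"
proof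
  fix M
  show "monomial_sum (distinct_lists m) mset M = fact m * elementary m M"
  proof (cases "mset_set (set_mset M) = M \<and> card (set_mset M) = m")
    case True
    have "mset xs = M \<longleftrightarrow> set xs = set_mset M" if "distinct xs" for xs
      using that True by (metis mset_set_set set_mset_mset)
    then have "{xs \<in> distinct_lists m. mset xs = M}
        = {xs. length xs = m \<and> distinct xs \<and> set xs \<subseteq> set_mset M}"
      using True
      by (auto simp: distinct_lists_def) (metis card_subset_eq distinct_card finite_set_mset subsetD)
    then have "card {xs \<in> distinct_lists m. mset xs = M} = fact m"
      using True by (simp add: card_lists_distinct_length_eq fact_prod)
    then show ?thesis using True by (simp add: monomial_sum_def elementary_eq)
  next
    case False
    have "{xs \<in> distinct_lists m. mset xs = M} = {}"
      using False by (auto simp: distinct_lists_def mset_set_set distinct_card)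
    then show ?thesis
      unfolding monomial_sum_def elementary_eq using False by (simp only: card.empty) auto
  qed
qed

lemma lollipop_series_0_right: "lollipop_series m 0 = monomial_sum (distinct_lists m) mset"
  unfolding lollipop_series_def
  by (rule monomial_sum_bij_betw[symmetric], rule bij_betwI[where g = fst and f = "\<lambda>xs. (xs, [])"])
    (auto simp: lollipop_lists_def path_lists_def)

lemma lollipop_series_0_left: "lollipop_series 0 n = monomial_sum (path_lists n) mset"
  unfolding lollipop_series_def
  by (rule monomial_sum_bij_betw[symmetric], rule bij_betwI[where g = snd and f = "\<lambda>ys. ([], ys)"])
    (auto simp: lollipop_lists_def distinct_lists_def)

lemma path_lists_Suc:
  "ys \<in> path_lists (Suc n) \<longleftrightarrow>
     (\<exists>z zs. ys = z # zs \<and> zs \<in> path_lists n \<and> (zs \<noteq> [] \<longrightarrow> z \<noteq> hd zs))"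
  by (cases ys) (auto simp: path_lists_def distinct_adj_Cons)

lemma distinct_lists_Suc:
  "xs \<in> distinct_lists (Suc m) \<longleftrightarrow>
     (\<exists>z zs. xs = z # zs \<and> zs \<in> distinct_lists m \<and> z \<notin> set zs)"
  by (cases xs) (auto simp: distinct_lists_def)

lemma lollipop_series_0_Suc: "lollipop_series 0 (Suc n) = lollipop_series 1 n"
  unfolding lollipop_series_def
  by (rule monomial_sum_bij_betw, rule bij_betwI[where g = "\<lambda>(xs, ys). ([], hd xs # ys)"
        and f = "\<lambda>(xs, ys). ([hd ys], tl ys)"])
    (auto simp: lollipop_lists_def path_lists_Suc distinct_lists_def length_Suc_conv)

lemma series_mult_lollipop_series:
  "series_mult (lollipop_series m 0) (lollipop_series 0 n)
     = monomial_sum (distinct_lists m \<times> path_lists n) (\<lambda>(xs, ys). mset xs + mset ys)"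
  unfolding lollipop_series_0_left lollipop_series_0_right
  by (rule series_mult_monomial_sum) (rule finite_mset_fibre)+

text \<open>
  In a colouring of the disjoint union of \<open>K\<^sub>m\<close> and \<open>P\<^sub>n\<^sub>+\<^sub>1\<close>, the first path vertex either avoids all
  colours of \<open>K\<^sub>m\<close>, so that it extends \<open>K\<^sub>m\<close> to \<open>K\<^sub>m\<^sub>+\<^sub>1\<close>, or it shares its colour with exactly one of
  the \<open>m\<close> vertices of \<open>K\<^sub>m\<close>, which are interchangeable.
\<close>

lemma lollipop_series_Suc:
  assumes "m \<noteq> 0"
  shows "of_nat m * lollipop_series m (Suc n) M
     = of_nat (m - 1) * series_mult (lollipop_series m 0) (lollipop_series 0 (Suc n)) M
       + lollipop_series (Suc m) n M"
proof -
  define w :: "nat list \<times> nat list \<Rightarrow> nat multiset" where "w = (\<lambda>(xs, ys). mset xs + mset ys)"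
  define D where "D = {p \<in> distinct_lists m \<times> path_lists (Suc n). w p = M}"
  define A where "A i = {(xs, ys) \<in> D. xs ! i = hd ys}" for i
  define N where "N = {(xs, ys) \<in> D. hd ys \<notin> set xs}"
  have "finite D"
    by (rule finite_subset[OF _ finite_mset_pair_fibre[of M]]) (auto simp: D_def w_def)
  then have fin: "finite (A i)" "finite N" for i
    by (auto simp: A_def N_def intro: rev_finite_subset)
  \<comment> \<open>The joining edge ends in clique vertex 0, so \<open>A 0\<close> consists of
    exactly the colourings that violate it.\<close>
  have L: "{p \<in> lollipop_lists m (Suc n). w p = M} = D - A 0"
    using assms
    by (auto simp: lollipop_lists_def D_def A_def distinct_lists_Suc path_lists_Suc distinct_lists_def hd_conv_nth)
  have cardA: "card (A i) = card (A 0)" if "i < m" for i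
  proof -
    define s where "s xs = xs[0 := xs ! i, i := xs ! 0]" for xs :: "nat list"
    have nth: "s xs ! j = (if j = i then xs ! 0 else if j = 0 then xs ! i else xs ! j)"
      if "length xs = m" "j < m" for xs j
    proof -
      have "0 < m" using \<open>i < m\<close> by simp
      then show ?thesis using that \<open>i < m\<close> by (simp add: s_def nth_list_update)
    qed
    have s: "mset (s xs) = mset xs" "length (s xs) = m" "distinct (s xs) = distinct xs"
        "s xs ! i = xs ! 0" "s xs ! 0 = xs ! i" "s (s xs) = xs" if "length xs = m" for xs
    proof -
      show *: "mset (s xs) = mset xs"
        unfolding s_def using that \<open>i < m\<close> by (intro mset_swap) auto
      then show "distinct (s xs) = distinct xs" by (rule mset_eq_imp_distinct_iff)
      show l: "length (s xs) = m"
        using that by (simp add: s_def)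
      then have "length (s (s xs)) = m" by (simp add: s_def)
      with l that \<open>i < m\<close> show "s (s xs) = xs"
        by (intro nth_equalityI) (simp_all add: nth)
      show "s xs ! i = xs ! 0" "s xs ! 0 = xs ! i"
        using that \<open>i < m\<close> by (simp_all add: nth)
    qed
    have "bij_betw (\<lambda>(xs, ys). (s xs, ys)) (A i) (A 0)"
      by (rule bij_betwI[where g = "\<lambda>(xs, ys). (s xs, ys)"])
        (auto simp: A_def D_def w_def distinct_lists_def s)
    then show ?thesis by (rule bij_betw_same_card)
  qed
  have disj: "\<forall>i\<in>{..<m}. \<forall>j\<in>{..<m}. i \<noteq> j \<longrightarrow> A i \<inter> A j = {}"
    by (auto simp: A_def D_def distinct_lists_def) (metis nth_eq_iff_index_eq)
  have "card (\<Union>i<m. A i) = (\<Sum>i<m. card (A i))"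
    using fin disj by (intro card_UN_disjoint) auto
  also have "\<dots> = (\<Sum>i<m. card (A 0))"
    by (intro sum.cong refl cardA) simp
  finally have "card (\<Union>i<m. A i) = m * card (A 0)" by simp
  moreover have "D = (\<Union>i<m. A i) \<union> N"
    by (auto simp: A_def N_def D_def distinct_lists_def in_set_conv_nth)
  moreover have "(\<Union>i<m. A i) \<inter> N = {}"
    by (auto simp: A_def N_def D_def distinct_lists_def) (metis nth_mem)
  ultimately have "card D = m * card (A 0) + card N"
    using fin by (simp add: card_Un_disjoint)
  \<comment> \<open>The first path vertex becomes vertex 0 of the larger clique, and its edge to the
    second path vertex becomes the new joining edge.\<close>
  moreover have "bij_betw (\<lambda>(xs, ys). (hd ys # xs, tl ys)) N {p \<in> lollipop_lists (Suc m) n. w p = M}"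
    by (rule bij_betwI[where g = "\<lambda>(xs, ys). (tl xs, hd xs # ys)"])
      (auto simp: N_def D_def w_def lollipop_lists_def distinct_lists_Suc path_lists_Suc)
  ultimately have D: "card D = m * card (A 0) + card {p \<in> lollipop_lists (Suc m) n. w p = M}"
    by (simp only: bij_betw_same_card)
  have "A 0 \<subseteq> D" by (auto simp: A_def)
  then have "card (D - A 0) = card D - card (A 0)" "card (A 0) \<le> card D"
    using fin \<open>finite D\<close> by (auto simp: card_Diff_subset card_mono)
  \<comment> \<open>Multiply \<open>card (D - A 0) = card D - card (A 0)\<close> by m and eliminate
    \<open>m * card (A 0)\<close> with \<open>D\<close>.\<close>
  then show ?thesis
    using D assms unfolding series_mult_lollipop_series unfolding lollipop_series_def monomial_sum_def
    unfolding w_def[symmetric] L D_def[symmetric]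
    by (simp add: of_nat_diff algebra_simps)
qed

section \<open>e-positivity of lollipops\<close>

lemma e_positive_scale: "e_positive f \<Longrightarrow> 0 \<le> a \<Longrightarrow> e_positive (\<lambda>M. a * f M)"
  unfolding e_positive_def by (rule nonneg_combination_scale)

lemma e_positive_add: "e_positive f \<Longrightarrow> e_positive g \<Longrightarrow> e_positive (\<lambda>M. f M + g M)"
  unfolding e_positive_def by (rule nonneg_combination_add)

lemma series_mult_scale_left: "series_mult (\<lambda>M. a * f M) g = (\<lambda>M. a * series_mult f g M)"
  by (simp add: series_mult_def sum_distrib_left mult.assoc)

text \<open>\<open>k = 0\<close> is separate because \<open>[0]\<close> is not a partition: there
  the basis element is that of the empty partition.\<close>

lemma e_positive_elementary: "e_positive (elementary k)"
proof (cases "k = 0")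
  case True
  have "elementary 0 = elementary_partition []"
    by (auto simp: fun_eq_iff elementary_eq elementary_partition_def series_one_def)
  then show ?thesis
    unfolding e_positive_def True by (auto intro: nonneg_combination_basis simp: is_partition_def)
next
  case False
  have "series_mult f series_one M = f M" for f M
  proof -
    have "series_mult f series_one M = (\<Sum>A\<in>{M}. f A * series_one (M - A))"
      unfolding series_mult_def
      by (rule sum.mono_neutral_right)
        (auto simp: finite_submultisets series_one_def Diff_eq_empty_iff_mset dest: subset_mset.antisym)
    then show ?thesis by (simp add: series_one_def)
  qed
  then have "elementary k = elementary_partition [k]"
    by (simp add: elementary_partition_def fun_eq_iff)
  then show ?thesis
    using False unfolding e_positive_def
    by (auto intro: nonneg_combination_basis simp: is_partition_def)
qed

text \<open>The recurrence shortens the path by enlarging the clique, so the induction on n is for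
  all m at once.\<close>

lemma e_positive_lollipop_series: "e_positive (lollipop_series m n)"
proof (induction n arbitrary: m)
  case 0
  show ?case
    unfolding lollipop_series_0_right monomial_sum_distinct_lists
    by (intro e_positive_scale e_positive_elementary) simp
next
  case (Suc n)
  \<comment> \<open>The path factor of the recurrence has the same length \<open>Suc n\<close>, but
    as a lollipop with a one-vertex clique it falls under the induction hypothesis. This also
    settles \<open>m = 0\<close>.\<close>
  have 1: "e_positive (lollipop_series 0 (Suc n))"
    unfolding lollipop_series_0_Suc by (rule Suc)
  show ?case
  proof (cases "m = 0")
    case False
    have "lollipop_series m (Suc n) = (\<lambda>M. (1 / of_nat m) * (of_nat (m - 1) *
        series_mult (lollipop_series m 0) (lollipop_series 0 (Suc n)) M + lollipop_series (Suc m) n M))"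
      unfolding lollipop_series_Suc[OF False, symmetric] using False by simp
    moreover have "e_positive \<dots>"
    proof (intro e_positive_scale e_positive_add Suc)
      show "e_positive (series_mult (lollipop_series m 0) (lollipop_series 0 (Suc n)))"
        unfolding lollipop_series_0_right monomial_sum_distinct_lists series_mult_scale_left
        by (intro e_positive_scale e_positive_series_mult_elementary 1 False) simp
    qed simp_all
    ultimately show ?thesis by simp
  qed (use 1 in simp)
qed

section \<open>Shapes and strips\<close>

text \<open>
  A shape is the function of its row lengths. Vertical strips are added to \<open>f\<close> (\<open>g / f\<close> is a strip),
  whereas horizontal strips are removed from it (\<open>f / g\<close> is a strip).
\<close>

definition finite_support :: "(nat \<Rightarrow> nat) \<Rightarrow> bool" where
  "finite_support f \<longleftrightarrow> finite {i. f i \<noteq> 0}"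

definition shape :: "(nat \<Rightarrow> nat) \<Rightarrow> bool" where
  "shape f \<longleftrightarrow> antimono f \<and> finite_support f"

definition shape_size :: "(nat \<Rightarrow> nat) \<Rightarrow> nat" where
  "shape_size f = sum f {i. f i \<noteq> 0}"

definition vertical_strips :: "(nat \<Rightarrow> nat) \<Rightarrow> nat \<Rightarrow> (nat \<Rightarrow> nat) set" where
  "vertical_strips f k = {g. shape g \<and> (\<forall>i. f i \<le> g i \<and> g i \<le> Suc (f i))
     \<and> shape_size g = shape_size f + k}"

text \<open>The interlacing inequalities say, in terms of row lengths, that no two removed cells
  share a column.\<close>

definition horizontal_strips :: "(nat \<Rightarrow> nat) \<Rightarrow> nat \<Rightarrow> (nat \<Rightarrow> nat) set" where
  "horizontal_strips f c = {g. shape g \<and> (\<forall>i. f (Suc i) \<le> g i \<and> g i \<le> f i)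
     \<and> shape_size f = shape_size g + c}"

lemma finite_support_bound:
  assumes "finite_support f"
  obtains R where "\<And>i. R \<le> i \<Longrightarrow> f i = 0"
proof -
  obtain R where "\<forall>i\<in>{i. f i \<noteq> 0}. i < R"
    using assms unfolding finite_support_def finite_nat_set_iff_bounded by blast
  then have "f i = 0" if "R \<le> i" for i
    using that by (auto simp flip: not_less)
  then show thesis by (rule that)
qed

lemma finite_support_mono: "finite_support g \<Longrightarrow> (\<And>i. f i \<le> g i) \<Longrightarrow> finite_support f"
  unfolding finite_support_def
  by (erule rev_finite_subset) (metis (mono_tags) Collect_mono le_zero_eq)

lemma finite_supportI: "(\<And>i. R \<le> i \<Longrightarrow> f i = 0) \<Longrightarrow> finite_support f"
  unfolding finite_support_def
  by (rule finite_subset[of _ "{..<R}"]) (force simp: not_less[symmetric])+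

lemma shape_size_eq_sum:
  "finite S \<Longrightarrow> (\<And>i. i \<notin> S \<Longrightarrow> f i = 0) \<Longrightarrow> shape_size f = sum f S"
  unfolding shape_size_def by (rule sum.mono_neutral_left) (auto intro: ccontr)

lemma shape_size_add:
  assumes "finite_support f" "finite_support g"
  shows "shape_size (\<lambda>i. f i + g i) = shape_size f + shape_size g"
proof -
  let ?S = "{i. f i \<noteq> 0} \<union> {i. g i \<noteq> 0}"
  have "finite ?S" using assms by (simp add: finite_support_def)
  then have "shape_size (\<lambda>i. f i + g i) = (\<Sum>i\<in>?S. f i + g i)" "shape_size f = sum f ?S"
      "shape_size g = sum g ?S"
    by (auto intro!: shape_size_eq_sum simp del: Un_iff)
  then show ?thesis by (simp add: sum.distrib)
qed

lemma shape_size_mono: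
  assumes "finite_support g" "\<And>i. f i \<le> g i"
  shows "shape_size f \<le> shape_size g"
proof -
  have "f i = 0" if "g i = 0" for i using assms(2)[of i] that by simp
  then have "shape_size f = sum f {i. g i \<noteq> 0}"
    using assms(1) by (intro shape_size_eq_sum) (auto simp: finite_support_def)
  then show ?thesis
    using assms(2) by (simp add: shape_size_def sum_mono)
qed

lemma shape_size_add_indicator:
  assumes "finite_support f" "finite S"
  shows "shape_size (\<lambda>i. f i + of_bool (i \<in> S)) = shape_size f + card S"
proof -
  have "shape_size (\<lambda>i. of_bool (i \<in> S)) = (\<Sum>i\<in>S. of_bool (i \<in> S))"
    using assms(2) by (intro shape_size_eq_sum) auto
  moreover have "finite_support (\<lambda>i. of_bool (i \<in> S))"
    using assms(2) by (simp add: finite_support_def)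
  ultimately show ?thesis
    using assms by (simp add: shape_size_add)
qed

lemma finite_pointwise_le:
  assumes "finite_support f"
  shows "finite {g :: nat \<Rightarrow> nat. \<forall>i. g i \<le> f i}"
proof (rule finite_subset)
  let ?S = "{i. f i \<noteq> 0}"
  show "{g. \<forall>i. g i \<le> f i}
      \<subseteq> {g. \<forall>i. (i \<in> ?S \<longrightarrow> g i \<in> (\<Union>i\<in>?S. {..f i})) \<and> (i \<notin> ?S \<longrightarrow> g i = 0)}"
    by (auto simp: le_0_eq) (metis le_0_eq)
  show "finite \<dots>"
    using assms by (intro finite_set_of_finite_funs) (auto simp: finite_support_def)
qed

text \<open>Every row has one or two options, so \<open>g\<close> amounts to the set of free rows in
  which it exceeds \<open>lo\<close>, and its size fixes the cardinality of that set.\<close>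

lemma card_between_add:
  fixes lo hi :: "nat \<Rightarrow> nat"
  assumes hi: "finite_support hi" and "\<And>i. lo i \<le> hi i" "\<And>i. hi i \<le> Suc (lo i)"
  shows "card {g. (\<forall>i. lo i \<le> g i \<and> g i \<le> hi i) \<and> shape_size g = shape_size lo + t}
    = card {i. lo i < hi i} choose t"
proof -
  let ?F = "{i. lo i < hi i}"
  let ?h = "\<lambda>S i. lo i + of_bool (i \<in> S)"
  have F: "finite ?F"
    using hi unfolding finite_support_def by (rule rev_finite_subset) auto
  have lo: "finite_support lo"
    using hi assms(2) by (rule finite_support_mono)
  have size: "shape_size (?h S) = shape_size lo + card S" if "S \<subseteq> ?F" for S
    using lo finite_subset[OF that F] by (rule shape_size_add_indicator)
  have bounds: "lo i \<le> ?h S i \<and> ?h S i \<le> hi i" if "S \<subseteq> ?F" for S i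
    using that assms(2) by (cases "i \<in> S") (auto simp: Suc_le_eq)
  have inv: "?h {i. lo i < g i} = g" if "\<forall>i. lo i \<le> g i \<and> g i \<le> hi i" for g
  proof
    fix i show "?h {i. lo i < g i} i = g i"
      using that[rule_format, of i] assms(3)[of i] by auto
  qed
  have sub: "{i. lo i < g i} \<subseteq> ?F" if "\<forall>i. lo i \<le> g i \<and> g i \<le> hi i" for g
    using that less_le_trans by blast
  have "bij_betw ?h {S. S \<subseteq> ?F \<and> card S = t}
      {g. (\<forall>i. lo i \<le> g i \<and> g i \<le> hi i) \<and> shape_size g = shape_size lo + t}"
  proof (rule bij_betwI[where g = "\<lambda>g. {i. lo i < g i}"])
    show "?h \<in> {S. S \<subseteq> ?F \<and> card S = t} \<rightarrow>
        {g. (\<forall>i. lo i \<le> g i \<and> g i \<le> hi i) \<and> shape_size g = shape_size lo + t}"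
      using size bounds by blast
    show "(\<lambda>g. {i. lo i < g i}) \<in> {g. (\<forall>i. lo i \<le> g i \<and> g i \<le> hi i) \<and> shape_size g = shape_size lo + t}
        \<rightarrow> {S. S \<subseteq> ?F \<and> card S = t}"
    proof
      fix g assume g: "g \<in> {g. (\<forall>i. lo i \<le> g i \<and> g i \<le> hi i) \<and> shape_size g = shape_size lo + t}"
      then have "shape_size g = shape_size lo + card {i. lo i < g i}"
        using size[OF sub[of g]] inv[of g] by simp
      then show "{i. lo i < g i} \<in> {S. S \<subseteq> ?F \<and> card S = t}"
        using g sub[of g] by simp
    qed
  qed (use inv in auto)
  then show ?thesis
    using n_subsets[OF F, of t] by (simp add: bij_betw_same_card)
qed

text \<open>Lowering t free rows means raising all the others, so the symmetry of binomial
  coefficients applies; for t larger than the number of free rows both sides vanish.\<close>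

lemma card_between_diff:
  fixes lo hi :: "nat \<Rightarrow> nat"
  assumes hi: "finite_support hi" and lh: "\<And>i. lo i \<le> hi i" "\<And>i. hi i \<le> Suc (lo i)"
  shows "card {g. (\<forall>i. lo i \<le> g i \<and> g i \<le> hi i) \<and> shape_size g + t = shape_size hi}
    = card {i. lo i < hi i} choose t"
proof -
  let ?F = "{i. lo i < hi i}"
  have F: "finite ?F"
    using hi unfolding finite_support_def by (rule rev_finite_subset) auto
  have lo: "finite_support lo"
    using hi lh(1) by (rule finite_support_mono)
  have "hi = (\<lambda>i. lo i + of_bool (i \<in> ?F))"
  proof
    fix i show "hi i = lo i + of_bool (i \<in> ?F)" using lh[of i] by auto
  qed
  then have size: "shape_size hi = shape_size lo + card ?F"
    using shape_size_add_indicator[OF lo F] by simp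
  show ?thesis
  proof (cases "t \<le> card ?F")
    case True
    then have "shape_size g + t = shape_size hi \<longleftrightarrow> shape_size g = shape_size lo + (card ?F - t)" for g
      using size by auto
    then show ?thesis
      using card_between_add[OF assms, of "card ?F - t"] True by (simp add: binomial_symmetric[symmetric])
  next
    case False
    have "shape_size lo \<le> shape_size g" if "\<forall>i. lo i \<le> g i \<and> g i \<le> hi i" for g
      using that by (intro shape_size_mono finite_support_mono[OF hi]) auto
    then have "shape_size g + t \<noteq> shape_size hi" if "\<forall>i. lo i \<le> g i \<and> g i \<le> hi i" for g
      using that False size by (metis add_le_mono less_le_not_le nat_add_left_cancel_less not_le)
    then have "{g. (\<forall>i. lo i \<le> g i \<and> g i \<le> hi i) \<and> shape_size g + t = shape_size hi} = {}"
      by blast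
    then show ?thesis using False by (simp only: card.empty) (simp add: binomial_eq_0)
  qed
qed


text \<open>Both sets consist of the rows \<open>i \<le> R\<close> with
  \<open>\<rho> i \<le> \<mu> i\<close> that are not blocked. An equality
  \<open>\<mu> (Suc j) = \<rho> j\<close> with \<open>j < R\<close> blocks row \<open>Suc j\<close>
  in the first set and row \<open>j\<close> in the second. In addition row \<open>R\<close>, where
  both shapes are already empty, is blocked in the second set; this is the difference of
  one.\<close>

lemma card_free_rows:
  assumes \<mu>: "shape \<mu>" and \<rho>: "shape \<rho>"
    and inter: "\<And>i. \<rho> i \<le> Suc (\<mu> i)" "\<And>i. \<mu> (Suc i) \<le> \<rho> i"
  shows "card {i. \<rho> i \<le> \<mu> i \<and> (i = 0 \<or> \<mu> i < \<rho> (i - 1))}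
       = Suc (card {i. \<rho> i \<le> \<mu> i \<and> \<mu> (Suc i) < \<rho> i})" (is "card ?L = Suc (card ?N)")
proof -
  obtain R1 R2 where R12: "\<And>i. R1 \<le> i \<Longrightarrow> \<mu> i = 0" "\<And>i. R2 \<le> i \<Longrightarrow> \<rho> i = 0"
    using \<mu> \<rho> finite_support_bound unfolding shape_def by meson
  define R where "R = max R1 R2"
  have R: "\<mu> i = 0" "\<rho> i = 0" if "R \<le> i" for i
    using R12 that by (auto simp: R_def)
  have anti: "\<mu> (Suc i) \<le> \<mu> i" "\<rho> (Suc i) \<le> \<rho> i" for i
    using \<mu> \<rho> by (auto simp: shape_def antimono_def)
  let ?G = "{i. i \<le> R \<and> \<rho> i \<le> \<mu> i}" and ?B = "{i. i < R \<and> \<mu> (Suc i) = \<rho> i}"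
  have G: "?L \<subseteq> ?G" "?N \<subseteq> ?G"
  proof -
    have "i \<le> R" if "i \<in> ?L" for i
    proof (rule ccontr)
      assume "\<not> i \<le> R"
      then have "R \<le> i - 1" "i \<noteq> 0" by auto
      then show False using R(2)[of "i - 1"] that by simp
    qed
    moreover have "i \<le> R" if "i \<in> ?N" for i
      using R(2)[of i] that by (cases "i \<le> R") auto
    ultimately show "?L \<subseteq> ?G" "?N \<subseteq> ?G" by auto
  qed
  have "?G - ?L = Suc ` ?B"
  proof (intro equalityI subsetI)
    fix i assume i: "i \<in> ?G - ?L"
    then obtain j where j: "i = Suc j" by (cases i) auto
    then have "j \<in> ?B" using i inter(2)[of j] by auto
    then show "i \<in> Suc ` ?B" using j by simp
  next
    fix i assume "i \<in> Suc ` ?B"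
    then obtain j where "i = Suc j" "j < R" "\<mu> (Suc j) = \<rho> j" by auto
    then show "i \<in> ?G - ?L" using anti(2)[of j] by auto
  qed
  then have L: "card ?G - card ?L = card ?B"
    using card_Diff_subset[OF finite_subset[OF G(1)] G(1)] by (simp add: card_image)
  have "?G - ?N = insert R ?B"
  proof (intro equalityI subsetI)
    fix i assume i: "i \<in> ?G - ?N"
    then have "\<mu> (Suc i) = \<rho> i" using inter(2)[of i] by auto
    then show "i \<in> insert R ?B" using i by auto
  next
    fix i assume i: "i \<in> insert R ?B"
    then have "\<mu> (Suc i) = \<rho> i" using R(1)[of "Suc R"] R(2)[of R] by auto
    then show "i \<in> ?G - ?N" using anti(1)[of i] i by auto
  qed
  then have "card ?G - card ?N = Suc (card ?B)"
    using card_Diff_subset[OF finite_subset[OF G(2)] G(2)] by simp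
  moreover have "card ?L \<le> card ?G" "card ?N \<le> card ?G"
    using G by (auto intro: card_mono)
  ultimately show ?thesis using L by linarith
qed

text \<open>
  On both sides the admissible values of \<open>g\<close> are independent from row to row, with one or two options
  each. If \<open>n\<close> rows are free for the shapes inside \<open>\<mu>\<close> and \<open>\<rho>\<close>, then \<open>n + 1\<close> rows are free for those
  around them, and the identity is Pascal's rule.
\<close>

lemma card_interlacing:
  assumes \<mu>: "shape \<mu>" and \<rho>: "shape \<rho>"
  shows "card {g. (\<forall>i. \<mu> i \<le> g i \<and> g i \<le> Suc (\<mu> i) \<and> g (Suc i) \<le> \<rho> i \<and> \<rho> i \<le> g i)
           \<and> shape_size g = shape_size \<mu> + k}
     = card {g. (\<forall>i. \<mu> (Suc i) \<le> g i \<and> g i \<le> \<mu> i \<and> g i \<le> \<rho> i \<and> \<rho> i \<le> Suc (g i))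
           \<and> shape_size g + k = shape_size \<rho>}
     + card {g. (\<forall>i. \<mu> (Suc i) \<le> g i \<and> g i \<le> \<mu> i \<and> g i \<le> \<rho> i \<and> \<rho> i \<le> Suc (g i))
           \<and> shape_size g + k = Suc (shape_size \<rho>)}"
    (is "card {g. (\<forall>i. ?l g i) \<and> _} = card {g. (\<forall>i. ?n g i) \<and> _} + _")
proof (cases "\<forall>i. \<rho> i \<le> Suc (\<mu> i) \<and> \<mu> (Suc i) \<le> \<rho> i")
  \<comment> \<open>Any \<open>g\<close> on either side would force both inequalities, so both sides
    count nothing.\<close>
  case False
  then obtain i where i: "Suc (\<mu> i) < \<rho> i \<or> \<rho> i < \<mu> (Suc i)" by (meson not_le)
  have "(\<forall>i. ?l g i) = False" for g
    using i by (metis le_trans not_le)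
  moreover have "(\<forall>i. ?n g i) = False" for g
    using i by (metis Suc_le_mono le_trans not_le)
  ultimately show ?thesis by (simp only: simp_thms empty_def[symmetric] card.empty add_0)
next
  case True
  then have inter: "\<rho> i \<le> Suc (\<mu> i)" "\<mu> (Suc i) \<le> \<rho> i" for i by auto
  have anti: "\<mu> (Suc i) \<le> \<mu> i" "\<rho> (Suc i) \<le> \<rho> i" for i
    using \<mu> \<rho> by (auto simp: shape_def antimono_def)
  define loL where "loL i = max (\<mu> i) (\<rho> i)" for i
  \<comment> \<open>The condition \<open>g (Suc i) \<le> \<rho> i\<close>, shifted by one row,
    leaves row 0 without a bound from \<open>\<rho>\<close>.\<close>
  define hiL where "hiL i = (if i = 0 then Suc (\<mu> i) else min (Suc (\<mu> i)) (\<rho> (i - 1)))" for i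
  define loN where "loN i = max (\<mu> (Suc i)) (\<rho> i - 1)" for i
  define hiN where "hiN i = min (\<mu> i) (\<rho> i)" for i
  define F where "F = card {i. loN i < hiN i}"
  have supp: "finite_support \<mu>" "finite_support \<rho>"
    using \<mu> \<rho> by (auto simp: shape_def)
  have l: "(\<forall>i. ?l g i) \<longleftrightarrow> (\<forall>i. loL i \<le> g i \<and> g i \<le> hiL i)" for g
  proof -
    have "(\<forall>i. g (Suc i) \<le> \<rho> i) \<longleftrightarrow> (\<forall>i. i \<noteq> 0 \<longrightarrow> g i \<le> \<rho> (i - 1))"
      by (metis diff_Suc_1 nat.exhaust nat.simps(3))
    then show ?thesis by (auto simp: loL_def hiL_def)
  qed
  have n: "(\<forall>i. ?n g i) \<longleftrightarrow> (\<forall>i. loN i \<le> g i \<and> g i \<le> hiN i)" for g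
    by (auto simp: loN_def hiN_def le_diff_conv)
  have hiL: "finite_support hiL"
  proof -
    obtain R1 R2 where "\<And>i. R1 \<le> i \<Longrightarrow> \<mu> i = 0" "\<And>i. R2 \<le> i \<Longrightarrow> \<rho> i = 0"
      using supp finite_support_bound by meson
    then show ?thesis
      by (intro finite_supportI[of "Suc (max R1 R2)"]) (auto simp: hiL_def)
  qed
  have hiN: "finite_support hiN"
    by (rule finite_support_mono[OF supp(1)]) (simp add: hiN_def)
  have leL: "loL i \<le> hiL i" "hiL i \<le> Suc (loL i)" for i
    using inter anti by (cases i; auto simp: loL_def hiL_def)+
  have leN: "loN i \<le> hiN i" "hiN i \<le> Suc (loN i)" for i
    using inter[of i] anti[of i] by (auto simp: loN_def hiN_def)
  have "{i. loL i < hiL i} = {i. \<rho> i \<le> \<mu> i \<and> (i = 0 \<or> \<mu> i < \<rho> (i - 1))}"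
  proof (intro Collect_cong)
    fix i show "loL i < hiL i \<longleftrightarrow> \<rho> i \<le> \<mu> i \<and> (i = 0 \<or> \<mu> i < \<rho> (i - 1))"
      using inter(1)[of i] by (auto simp: loL_def hiL_def)
  qed
  moreover have "{i. loN i < hiN i} = {i. \<rho> i \<le> \<mu> i \<and> \<mu> (Suc i) < \<rho> i}"
  proof (intro Collect_cong)
    fix i show "loN i < hiN i \<longleftrightarrow> \<rho> i \<le> \<mu> i \<and> \<mu> (Suc i) < \<rho> i"
      using inter[of i] anti[of i] by (auto simp: loN_def hiN_def)
  qed
  ultimately have F: "card {i. loL i < hiL i} = Suc F"
    using card_free_rows[OF \<mu> \<rho> inter] by (simp add: F_def)
  have "finite_support loL"
    using hiL leL(1) by (rule finite_support_mono)
  \<comment> \<open>Since max plus min is the sum, the excess over \<open>loL\<close> around the two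
    shapes can be matched with the deficit below \<open>hiN\<close> inside them.\<close>
  then have "shape_size loL + shape_size hiN = shape_size (\<lambda>i. loL i + hiN i)"
    using hiN by (simp add: shape_size_add)
  also have "(\<lambda>i. loL i + hiN i) = (\<lambda>i. \<mu> i + \<rho> i)"
    by (auto simp: loL_def hiN_def)
  finally have size: "shape_size loL + shape_size hiN = shape_size \<mu> + shape_size \<rho>"
    using supp by (simp add: shape_size_add)
  have geL: "shape_size loL \<le> shape_size g" if "\<forall>i. loL i \<le> g i \<and> g i \<le> hiL i" for g
    using that by (intro shape_size_mono finite_support_mono[OF hiL]) auto
  have leN': "shape_size g \<le> shape_size hiN" if "\<forall>i. loN i \<le> g i \<and> g i \<le> hiN i" for g
    using that by (intro shape_size_mono hiN) auto
  show ?thesis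
  proof (cases "shape_size loL \<le> shape_size \<mu> + k")
    case False
    have "shape_size g \<noteq> shape_size \<mu> + k" if "\<forall>i. ?l g i" for g
      using geL[OF that[unfolded l]] False by linarith
    then have "{g. (\<forall>i. ?l g i) \<and> shape_size g = shape_size \<mu> + k} = {}" by blast
    moreover have "shape_size g + k \<noteq> shape_size \<rho>" "shape_size g + k \<noteq> Suc (shape_size \<rho>)"
      if "\<forall>i. ?n g i" for g
      using leN'[OF that[unfolded n]] size False by linarith+
    then have "{g. (\<forall>i. ?n g i) \<and> shape_size g + k = shape_size \<rho>} = {}"
        "{g. (\<forall>i. ?n g i) \<and> shape_size g + k = Suc (shape_size \<rho>)} = {}"
      by blast+
    ultimately show ?thesis by (simp only: card.empty)
  next
    case True
    \<comment> \<open>\<open>t\<close> is the number of free rows raised above \<open>loL\<close>.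
      By \<open>size\<close>, the two sets on the right lower t and t - 1 free rows below
      \<open>hiN\<close>, the latter being impossible for \<open>t = 0\<close>.\<close>
    define t where "t = shape_size \<mu> + k - shape_size loL"
    have t: "shape_size \<mu> + k = shape_size loL + t" using True by (simp add: t_def)
    have 1: "card {g. (\<forall>i. ?l g i) \<and> shape_size g = shape_size \<mu> + k} = Suc F choose t"
      unfolding l t F[symmetric] by (rule card_between_add[OF hiL leL])
    have "shape_size g + k = shape_size \<rho> \<longleftrightarrow> shape_size g + t = shape_size hiN" for g
      using t size by linarith
    then have 2: "card {g. (\<forall>i. ?n g i) \<and> shape_size g + k = shape_size \<rho>} = F choose t"
      unfolding n F_def by (simp only: card_between_diff[OF hiN leN])
    have eq: "shape_size g + k = Suc (shape_size \<rho>) \<longleftrightarrow> shape_size g + t = Suc (shape_size hiN)" for g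
      using t size by linarith
    show ?thesis
    proof (cases t)
      case 0
      have "shape_size g + t \<noteq> Suc (shape_size hiN)" if "\<forall>i. ?n g i" for g
        using leN'[OF that[unfolded n]] 0 by linarith
      then have "{g. (\<forall>i. ?n g i) \<and> shape_size g + k = Suc (shape_size \<rho>)} = {}"
        unfolding eq by blast
      then show ?thesis unfolding 1 2 by (simp only: card.empty) (simp add: 0)
    next
      case (Suc t')
      have "card {g. (\<forall>i. ?n g i) \<and> shape_size g + k = Suc (shape_size \<rho>)} = F choose t'"
        unfolding n eq F_def Suc by (simp add: card_between_diff[OF hiN leN])
      then show ?thesis unfolding 1 2 by (simp add: Suc)
    qed
  qed
qed

section \<open>Tableaux\<close>

definition diagram :: "(nat \<Rightarrow> nat) \<Rightarrow> (nat \<times> nat) set" where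
  "diagram f = {(i, j). j < f i}"

definition tableaux :: "(nat \<Rightarrow> nat) \<Rightarrow> (nat \<times> nat \<Rightarrow> nat) set" where
  "tableaux f = {T \<in> diagram f \<rightarrow>\<^sub>E UNIV.
     (\<forall>i j. (i, j) \<in> diagram f \<and> (i, Suc j) \<in> diagram f \<longrightarrow> T (i, j) \<le> T (i, Suc j)) \<and>
     (\<forall>i j. (i, j) \<in> diagram f \<and> (Suc i, j) \<in> diagram f \<longrightarrow> T (i, j) < T (Suc i, j))}"

definition content :: "(nat \<Rightarrow> nat) \<Rightarrow> (nat \<times> nat \<Rightarrow> nat) \<Rightarrow> nat multiset" where
  "content f T = image_mset T (mset_set (diagram f))"

text \<open>For a shape \<open>f\<close> this is the Kostka number of shape \<open>f\<close> and
  content \<open>M\<close>.\<close>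

definition tableau_count :: "(nat \<Rightarrow> nat) \<Rightarrow> nat multiset \<Rightarrow> nat" where
  "tableau_count f M = card {T \<in> tableaux f. content f T = M}"

lemma diagram_iff [simp]: "(i, j) \<in> diagram f \<longleftrightarrow> j < f i"
  by (simp add: diagram_def)

lemma diagram_eq_Sigma: "diagram f = (SIGMA i:{i. f i \<noteq> 0}. {..<f i})"
  by (auto simp: diagram_def)

lemma finite_diagram: "finite_support f \<Longrightarrow> finite (diagram f)"
  by (simp add: diagram_eq_Sigma finite_support_def)

lemma card_diagram: "finite_support f \<Longrightarrow> card (diagram f) = shape_size f"
  by (simp add: diagram_eq_Sigma finite_support_def shape_size_def)

lemma inj_diagram: "diagram f = diagram g \<Longrightarrow> f = g"
proof
  fix i assume "diagram f = diagram g"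
  then have "{..<f i} = {..<g i}" by (auto simp: set_eq_iff diagram_def)
  then show "f i = g i" by simp
qed

lemma diagram_mono: "(\<And>i. g i \<le> f i) \<Longrightarrow> diagram g \<subseteq> diagram f"
  using less_le_trans by (fastforce simp: diagram_def)

lemma set_mset_content: "finite_support f \<Longrightarrow> set_mset (content f T) = T ` diagram f"
  by (simp add: content_def finite_diagram)

lemma size_content: "finite_support f \<Longrightarrow> size (content f T) = shape_size f"
  by (simp add: content_def finite_diagram card_diagram)

lemma finite_tableaux_content:
  assumes "finite_support f"
  shows "finite {T \<in> tableaux f. content f T = M}"
  by (rule finite_subset[OF _ finite_filling_fibre[OF finite_diagram[OF assms], of M]])
    (auto simp: tableaux_def content_def)

lemma tableau_count_empty:
  assumes "finite_support f" "shape_size f \<noteq> 0"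
  shows "tableau_count f {#} = 0"
proof -
  have "content f T \<noteq> {#}" for T
    using size_content[OF assms(1), of T] assms(2) by auto
  then show ?thesis by (simp add: tableau_count_def)
qed

lemma finite_horizontal_strips: "finite_support f \<Longrightarrow> finite (horizontal_strips f c)"
  by (rule finite_subset[OF _ finite_pointwise_le[of f]]) (auto simp: horizontal_strips_def)

lemma finite_vertical_strips:
  assumes "shape f"
  shows "finite (vertical_strips f k)"
proof -
  obtain R where R: "\<And>i. R \<le> i \<Longrightarrow> f i = 0"
    using assms finite_support_bound unfolding shape_def by meson
  \<comment> \<open>If some row \<open>i \<ge> R + k\<close> of \<open>g\<close> were nonempty, all
    k + 1 rows from \<open>R\<close> to \<open>R + k\<close> would be, one cell more than the strip
    has.\<close>
  let ?h = "\<lambda>i. if i < R + k then Suc (f i) else 0"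
  have "g i \<le> ?h i" if g: "g \<in> vertical_strips f k" for g i
  proof (cases "i < R + k")
    case True
    then show ?thesis using g by (simp add: vertical_strips_def)
  next
    case False
    have "g i = 0"
    proof (rule ccontr)
      assume "g i \<noteq> 0"
      then have pos: "0 < g j" if "j \<le> i" for j
        using g that by (auto simp: vertical_strips_def shape_def antimono_def dest: less_le_trans)
      have "f j + of_bool (j \<in> {R..R + k}) \<le> g j" for j
        using pos[of j] R[of j] g False by (auto simp: vertical_strips_def)
      then have "shape_size (\<lambda>j. f j + of_bool (j \<in> {R..R + k})) \<le> shape_size g"
        using g by (intro shape_size_mono) (auto simp: vertical_strips_def shape_def)
      then show False
        using shape_size_add_indicator[of f "{R..R + k}"] g assms
        by (simp add: shape_def vertical_strips_def)
    qed
    then show ?thesis by simp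
  qed
  then have "vertical_strips f k \<subseteq> {g. \<forall>i. g i \<le> ?h i}" by blast
  moreover have "finite {g. \<forall>i. g i \<le> ?h i}"
    by (intro finite_pointwise_le finite_supportI[of "R + k"]) simp
  ultimately show ?thesis by (rule finite_subset)
qed

section \<open>Removing the largest entry of a tableau\<close>

lemma content_superset:
  assumes "finite_support f" "\<And>i. g i \<le> f i" "\<And>x. x \<in> diagram f \<Longrightarrow> x \<notin> diagram g \<Longrightarrow> T x = a"
  shows "content f T = content g T + replicate_mset (shape_size f - shape_size g) a"
proof -
  have g: "finite_support g" using assms(1,2) by (rule finite_support_mono)
  have sub: "diagram g \<subseteq> diagram f" using assms(2) by (rule diagram_mono)
  have "mset_set (diagram f) = mset_set (diagram g) + mset_set (diagram f - diagram g)"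
    using sub assms(1) finite_diagram finite_subset
    by (subst mset_set_Union[symmetric]) (auto intro: finite_subset simp: Un_absorb1)
  then have "content f T = content g T + image_mset T (mset_set (diagram f - diagram g))"
    by (simp add: content_def)
  also have "image_mset T (mset_set (diagram f - diagram g))
      = image_mset (\<lambda>x. a) (mset_set (diagram f - diagram g))"
    using assms(1) by (intro image_mset_cong) (auto simp: finite_diagram assms(3))
  also have "\<dots> = replicate_mset (shape_size f - shape_size g) a"
    using sub assms(1) g finite_diagram
    by (simp add: image_mset_const_eq card_Diff_subset card_diagram)
  finally show ?thesis .
qed

lemma down_closed_eq_lessThan:
  fixes S :: "nat set"
  assumes "finite S" "\<And>i j. j \<in> S \<Longrightarrow> i \<le> j \<Longrightarrow> i \<in> S"
  shows "S = {..<card S}"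
proof (cases "S = {}")
  case False
  then have "S = {..Max S}" using assms by (auto intro: Max_ge Max_in)
  then have "S = {..<Suc (Max S)}" by (simp only: lessThan_Suc_atMost)
  then show ?thesis by (metis card_lessThan)
qed simp

text \<open>Entries below \<open>a\<close> fill an initial segment of each row. If
  \<open>g i < f (Suc i)\<close>, then the cell \<open>(i, g i)\<close> would carry \<open>a\<close>
  and the cell under it an entry larger than \<open>a\<close>.\<close>

lemma tableau_below_shape:
  assumes T: "T \<in> tableaux f" and f: "antimono f" and le: "\<And>x. x \<in> diagram f \<Longrightarrow> T x \<le> a"
  obtains g where "{x \<in> diagram f. T x < a} = diagram g" "\<And>i. f (Suc i) \<le> g i" "\<And>i. g i \<le> f i"
proof -
  define g where "g i = card {j. j < f i \<and> T (i, j) < a}" for i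
  have row: "T (i, j) \<le> T (i, Suc j)" if "Suc j < f i" for i j
    using T that by (simp add: tableaux_def)
  have col: "T (i, j) < T (Suc i, j)" if "j < f i" "j < f (Suc i)" for i j
    using T that by (simp add: tableaux_def)
  have rows: "T (i, j) \<le> T (i, j')" if "j \<le> j'" "j' < f i" for i j j'
    using that by (induction j' rule: dec_induct) (auto intro: order_trans row)
  have down: "{j. j < f i \<and> T (i, j) < a} = {..<g i}" for i
    unfolding g_def by (rule down_closed_eq_lessThan) (auto dest: rows)
  have mem: "j < g i \<longleftrightarrow> j < f i \<and> T (i, j) < a" for i j
    using down[of i] by blast
  have "g i \<le> f i" for i
    unfolding g_def by (rule order_trans[OF card_mono[of "{..<f i}"]]) auto
  moreover have "f (Suc i) \<le> g i" for i
  proof (rule ccontr)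
    assume "\<not> f (Suc i) \<le> g i"
    then have *: "g i < f (Suc i)" by simp
    also have "f (Suc i) \<le> f i" using f by (simp add: antimono_def)
    finally have "g i < f i" .
    then have "T (i, g i) < T (Suc i, g i)" using * by (rule col)
    also have "\<dots> \<le> a" using * by (intro le) simp
    finally show False using mem[of "g i" i] \<open>g i < f i\<close> by simp
  qed
  moreover have "{x \<in> diagram f. T x < a} = diagram g"
    using mem by (auto simp: diagram_def)
  ultimately show thesis using that by blast
qed

text \<open>By \<open>f (Suc i) \<le> g i\<close>, every cell with a cell of \<open>f\<close>
  directly under it lies in \<open>g\<close>; hence no two new entries \<open>a\<close> meet in a
  column.\<close>

lemma extend_tableau:
  assumes T: "T \<in> tableaux g" and gf: "\<And>i. g i \<le> f i" "\<And>i. f (Suc i) \<le> g i"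
    and less: "\<And>x. x \<in> diagram g \<Longrightarrow> T x < a"
  shows "(\<lambda>x\<in>diagram f. if x \<in> diagram g then T x else a) \<in> tableaux f"
proof -
  have "T (i, j) \<le> T (i, Suc j)" if "Suc j < g i" for i j
    using T that by (simp add: tableaux_def)
  moreover have "T (i, j) < T (Suc i, j)" if "j < g i" "j < g (Suc i)" for i j
    using T that by (simp add: tableaux_def)
  moreover have "j < g i" if "j < f (Suc i)" for i j
    using gf(2)[of i] that by simp
  moreover have "T (i, j) < a" if "j < g i" for i j
    using that by (intro less) simp
  ultimately show ?thesis
    by (auto simp: tableaux_def intro: less_imp_le)
qed

lemma restrict_tableau:
  assumes T: "T \<in> tableaux f" and gf: "\<And>i. g i \<le> f i"
  shows "restrict T (diagram g) \<in> tableaux g"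
proof -
  have "j < f i" if "j < g i" for i j
    using that gf less_le_trans by blast
  then show ?thesis using T by (simp add: tableaux_def)
qed

text \<open>The cells of the largest entry form a horizontal strip, and removing them leaves a tableau.\<close>

lemma tableau_count_remove_largest:
  assumes f: "shape f" and less: "\<And>x. x \<in># M \<Longrightarrow> x < a"
  shows "tableau_count f (M + replicate_mset c a) = (\<Sum>g\<in>horizontal_strips f c. tableau_count g M)"
proof -
  \<comment> \<open>The tableaux are classified by the shape \<open>g\<close> that their entries
    below \<open>a\<close> occupy.\<close>
  let ?X = "\<lambda>g. {T \<in> tableaux f. content f T = M + replicate_mset c a \<and> {x \<in> diagram f. T x < a} = diagram g}"
  have supp: "finite_support f" using f by (simp add: shape_def)
  have strip: "g \<in> horizontal_strips f c \<and> content g T = M"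
    if T: "T \<in> tableaux f" "content f T = M + replicate_mset c a"
      and g: "{x \<in> diagram f. T x < a} = diagram g" "\<And>i. f (Suc i) \<le> g i" "\<And>i. g i \<le> f i" for T g
  proof -
    have suppg: "finite_support g" using supp g(3) by (rule finite_support_mono)
    have anti: "antimono g"
      unfolding antimono_iff_le_Suc using g(2,3) by (meson order_trans)
    have le: "T x \<le> a" if "x \<in> diagram f" for x
    proof -
      have "T x \<in># M + replicate_mset c a"
        using that T(2) set_mset_content[OF supp, of T] by auto
      then show ?thesis using less by (auto split: if_splits intro: less_imp_le)
    qed
    have Ta: "T x = a" if "x \<in> diagram f" "x \<notin> diagram g" for x
      using le[OF that(1)] that g(1) by force
    let ?d = "shape_size f - shape_size g"
    have eq: "M + replicate_mset c a = content g T + replicate_mset ?d a"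
      using content_superset[OF supp g(3) Ta] T(2) by simp
    \<comment> \<open>As \<open>a\<close> occurs in neither multiset, counting it in
      \<open>eq\<close> gives the size of the strip.\<close>
    have "a \<notin># content g T" "a \<notin># M"
      using g(1) less by (auto simp: set_mset_content[OF suppg])
    then have "c = ?d"
      using arg_cong[OF eq, of "\<lambda>M. count M a"] by (simp add: not_in_iff)
    moreover have "shape_size g \<le> shape_size f"
      using supp g(3) by (rule shape_size_mono)
    ultimately show ?thesis
      using eq g(2,3) anti suppg by (simp add: horizontal_strips_def shape_def)
  qed
  have "{T \<in> tableaux f. content f T = M + replicate_mset c a} = (\<Union>g\<in>horizontal_strips f c. ?X g)"
  proof (intro equalityI subsetI)
    fix T assume T: "T \<in> {T \<in> tableaux f. content f T = M + replicate_mset c a}"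
    have "T x \<le> a" if "x \<in> diagram f" for x
    proof -
      have "T x \<in># M + replicate_mset c a"
        using that T set_mset_content[OF supp, of T] by auto
      then show ?thesis using less by (auto split: if_splits intro: less_imp_le)
    qed
    then obtain g where "{x \<in> diagram f. T x < a} = diagram g" "\<And>i. f (Suc i) \<le> g i" "\<And>i. g i \<le> f i"
      using T f tableau_below_shape[of T f a] unfolding shape_def by blast
    then show "T \<in> (\<Union>g\<in>horizontal_strips f c. ?X g)"
      using strip[of T g] T by blast
  qed blast
  moreover have "finite (?X g)" for g
    by (rule finite_subset[OF _ finite_tableaux_content[OF supp, of "M + replicate_mset c a"]]) blast
  moreover have "?X g \<inter> ?X h = {}" if "g \<noteq> h" for g h
    using that inj_diagram by fastforce
  ultimately have "tableau_count f (M + replicate_mset c a) = (\<Sum>g\<in>horizontal_strips f c. card (?X g))"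
    unfolding tableau_count_def using finite_horizontal_strips[OF supp]
    by (simp add: card_UN_disjoint)
  also have "\<dots> = (\<Sum>g\<in>horizontal_strips f c. tableau_count g M)"
    unfolding tableau_count_def
  proof (intro sum.cong refl bij_betw_same_card)
    fix g assume "g \<in> horizontal_strips f c"
    then have g: "\<And>i. f (Suc i) \<le> g i" "\<And>i. g i \<le> f i" "shape_size f - shape_size g = c"
        "finite_support g"
      by (auto simp: horizontal_strips_def shape_def)
    have sub: "diagram g \<subseteq> diagram f" using g(2) by (rule diagram_mono)
    let ?E = "\<lambda>T. \<lambda>x\<in>diagram f. if x \<in> diagram g then T x else a"
    have cong: "content g T = content g T'" if "\<And>x. x \<in> diagram g \<Longrightarrow> T x = T' x" for T T'
      unfolding content_def using that by (intro image_mset_cong) (simp add: finite_diagram g(4))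
    show "bij_betw (\<lambda>T. restrict T (diagram g)) (?X g) {T \<in> tableaux g. content g T = M}"
    proof (rule bij_betwI[where g = ?E])
      show "(\<lambda>T. restrict T (diagram g)) \<in> ?X g \<rightarrow> {T \<in> tableaux g. content g T = M}"
      proof
        fix T assume T: "T \<in> ?X g"
        then have "content g (restrict T (diagram g)) = M"
          using strip[of T g] g(1,2) cong[of "restrict T (diagram g)" T] by auto
        then show "restrict T (diagram g) \<in> {T \<in> tableaux g. content g T = M}"
          using restrict_tableau[of T f g] T g(2) by auto
      qed
      show "?E \<in> {T \<in> tableaux g. content g T = M} \<rightarrow> ?X g"
      proof
        fix T assume T: "T \<in> {T \<in> tableaux g. content g T = M}"
        have lt: "T x < a" if "x \<in> diagram g" for x
          using that T set_mset_content[OF g(4), of T] by (intro less) auto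
        have "content f (?E T) = content g (?E T) + replicate_mset (shape_size f - shape_size g) a"
          using g(2) by (intro content_superset[OF supp]) auto
        moreover have "content g (?E T) = content g T"
          using sub by (intro cong) auto
        moreover have "{x \<in> diagram f. ?E T x < a} = diagram g"
          using lt sub by auto
        ultimately show "?E T \<in> ?X g"
          using extend_tableau[of T g f a] T g lt by auto
      qed
      show "?E (restrict T (diagram g)) = T" if T: "T \<in> ?X g" for T
      proof
        fix x show "?E (restrict T (diagram g)) x = T x"
        proof (cases "x \<in> diagram f")
          case True
          have "T x \<in># M + replicate_mset c a"
            using True T set_mset_content[OF supp, of T] by auto
          then have "T x \<le> a" using less by (auto split: if_splits intro: less_imp_le)
          moreover have "x \<in> diagram g \<longleftrightarrow> T x < a" using T True by blast
          ultimately show ?thesis using True by auto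
        next
          case False
          have "T \<in> diagram f \<rightarrow>\<^sub>E UNIV" using T unfolding tableaux_def by blast
          then show ?thesis using PiE_arb[of T _ _ x] False by simp
        qed
      qed
      show "restrict (?E T) (diagram g) = T" if "T \<in> {T \<in> tableaux g. content g T = M}" for T
      proof
        have T: "T \<in> diagram g \<rightarrow>\<^sub>E UNIV" using that unfolding tableaux_def by blast
        fix x show "restrict (?E T) (diagram g) x = T x"
          using sub PiE_arb[OF T, of x] by (cases "x \<in> diagram g") auto
      qed
    qed
  qed
  finally show ?thesis .
qed


section \<open>The Pieri rule\<close>

text \<open>All copies of the largest element are removed at once, so that one step corresponds to
  one whole horizontal strip.\<close>

lemma multiset_remove_largest_induct [case_names empty add]:
  fixes M :: "nat multiset"
  assumes "P {#}"
    and "\<And>M a c. (\<And>x. x \<in># M \<Longrightarrow> x < a) \<Longrightarrow> P M \<Longrightarrow> P (M + replicate_mset (Suc c) a)"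
  shows "P M"
proof (induction "size M" arbitrary: M rule: less_induct)
  case less
  show ?case
  proof (cases "M = {#}")
    case False
    define a where "a = Max (set_mset M)"
    define N where "N = filter_mset (\<lambda>x. x \<noteq> a) M"
    have a: "a \<in># M" "\<And>x. x \<in># M \<Longrightarrow> x \<le> a"
      using False by (auto simp: a_def)
    then obtain c where "count M a = Suc c"
      by (metis count_eq_zero_iff nat.exhaust)
    then have M: "M = N + replicate_mset (Suc c) a"
      by (intro multiset_eqI) (auto simp: N_def)
    have "P N" by (rule less) (simp add: M)
    moreover have "x < a" if "x \<in># N" for x
      using that a(2)[of x] by (auto simp: N_def)
    ultimately show ?thesis unfolding M by (intro assms(2))
  qed (simp add: assms(1))
qed

text \<open>Turns a sum over two-step routes into a sum over their end shapes, weighted by the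
  number of intermediate shapes. The common set \<open>U\<close> makes different kinds of routes
  comparable term by term.\<close>

lemma sum_double_count:
  fixes w :: "'b \<Rightarrow> nat"
  assumes "finite A" "finite U" "\<And>x. x \<in> A \<Longrightarrow> B x \<subseteq> U"
  shows "(\<Sum>x\<in>A. \<Sum>y\<in>B x. w y) = (\<Sum>y\<in>U. card {x \<in> A. y \<in> B x} * w y)"
proof -
  have "(\<Sum>x\<in>A. \<Sum>y\<in>B x. w y) = (\<Sum>x\<in>A. \<Sum>y\<in>{y \<in> U. y \<in> B x}. w y)"
    using assms(3) by (intro sum.cong refl) auto
  also have "\<dots> = (\<Sum>y\<in>U. \<Sum>x\<in>{x \<in> A. y \<in> B x}. w y)"
    using assms(1,2) by (rule sum.swap_restrict)
  finally show ?thesis by simp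
qed

text \<open>\<open>card_interlacing\<close> counts arbitrary functions;
  \<open>g (Suc i) \<le> \<rho> i \<le> g i\<close> already makes them decreasing and eventually
  zero, so that they are the strips in question.\<close>

lemma shape_interlacing_above:
  assumes "shape \<mu>" "\<forall>i. g i \<le> Suc (\<mu> i) \<and> g (Suc i) \<le> \<rho> i \<and> \<rho> i \<le> g i" "shape \<rho>"
  shows "shape g"
proof -
  obtain R where R: "\<And>i. R \<le> i \<Longrightarrow> \<rho> i = 0"
    using assms(3) finite_support_bound unfolding shape_def by meson
  have "g i = 0" if "Suc R \<le> i" for i
    using R[of "i - 1"] assms(2)[rule_format, of "i - 1"] that by simp
  then have "finite_support g" by (rule finite_supportI)
  moreover have "antimono g"
    unfolding antimono_iff_le_Suc using assms(2) by (meson order_trans)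
  ultimately show ?thesis by (simp add: shape_def)
qed

lemma shape_interlacing_below:
  assumes "shape \<mu>" "\<forall>i. \<mu> (Suc i) \<le> g i \<and> g i \<le> \<mu> i"
  shows "shape g"
proof -
  have "finite_support g"
    using assms by (intro finite_support_mono[of \<mu> g]) (auto simp: shape_def)
  moreover have "antimono g"
    unfolding antimono_iff_le_Suc using assms(2) by (meson order_trans)
  ultimately show ?thesis by (simp add: shape_def)
qed

text \<open>The strip conditions on each route unfold to those of \<open>card_interlacing\<close>.
  \<open>k = 0\<close> is set apart because \<open>k - 1\<close> is truncated; there the last count
  of \<open>card_interlacing\<close> vanishes, as its \<open>g\<close> lie inside
  \<open>\<rho>\<close>.\<close>

lemma card_strips_commute:
  assumes "shape \<mu>" "shape \<rho>"
  shows "card {g \<in> vertical_strips \<mu> k. \<rho> \<in> horizontal_strips g (Suc c)}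
    = card {g \<in> horizontal_strips \<mu> (Suc c). \<rho> \<in> vertical_strips g k}
    + (if k = 0 then 0 else card {g \<in> horizontal_strips \<mu> c. \<rho> \<in> vertical_strips g (k - 1)})"
\<comment> \<open>Every route changes the size by k - (c + 1), so without this equation there is
  none.\<close>
proof (cases "shape_size \<mu> + k = shape_size \<rho> + Suc c")
  case True
  let ?n = "\<lambda>g. \<forall>i. \<mu> (Suc i) \<le> g i \<and> g i \<le> \<mu> i \<and> g i \<le> \<rho> i \<and> \<rho> i \<le> Suc (g i)"
  have "{g \<in> vertical_strips \<mu> k. \<rho> \<in> horizontal_strips g (Suc c)}
      = {g. (\<forall>i. \<mu> i \<le> g i \<and> g i \<le> Suc (\<mu> i) \<and> g (Suc i) \<le> \<rho> i \<and> \<rho> i \<le> g i)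
           \<and> shape_size g = shape_size \<mu> + k}"
    using True assms shape_interlacing_above[of \<mu> _ \<rho>]
    by (auto simp: vertical_strips_def horizontal_strips_def)
  moreover have "{g \<in> horizontal_strips \<mu> (Suc c). \<rho> \<in> vertical_strips g k}
      = {g. ?n g \<and> shape_size g + k = shape_size \<rho>}"
    using True assms shape_interlacing_below[of \<mu>]
    by (auto simp: vertical_strips_def horizontal_strips_def)
  moreover have "card {g. ?n g \<and> shape_size g + k = Suc (shape_size \<rho>)}
      = (if k = 0 then 0 else card {g \<in> horizontal_strips \<mu> c. \<rho> \<in> vertical_strips g (k - 1)})"
  proof (cases k)
    case 0
    have "shape_size g + k \<noteq> Suc (shape_size \<rho>)" if "?n g" for g
    proof -
      have "shape_size g \<le> shape_size \<rho>"
        using assms(2) that by (intro shape_size_mono) (auto simp: shape_def)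
      then show ?thesis using 0 by simp
    qed
    then have "{g. ?n g \<and> shape_size g + k = Suc (shape_size \<rho>)} = {}" by blast
    then show ?thesis using 0 by (simp only: card.empty) simp
  next
    case (Suc k')
    have "{g \<in> horizontal_strips \<mu> c. \<rho> \<in> vertical_strips g k'}
        = {g. ?n g \<and> shape_size g + k = Suc (shape_size \<rho>)}"
      using True assms shape_interlacing_below[of \<mu>] Suc
      by (auto simp: vertical_strips_def horizontal_strips_def)
    then show ?thesis using Suc by simp
  qed
  ultimately show ?thesis using card_interlacing[OF assms, of k] by (simp only:)
next
  case False
  then have "{g \<in> vertical_strips \<mu> k. \<rho> \<in> horizontal_strips g (Suc c)} = {}"
      "{g \<in> horizontal_strips \<mu> (Suc c). \<rho> \<in> vertical_strips g k} = {}"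
      "k \<noteq> 0 \<Longrightarrow> {g \<in> horizontal_strips \<mu> c. \<rho> \<in> vertical_strips g (k - 1)} = {}"
    by (auto simp: vertical_strips_def horizontal_strips_def)
  then show ?thesis
    by (cases "k = 0") (simp_all only: if_True if_False card.empty add_0 simp_thms)
qed

lemma sum_strips_commute:
  fixes w :: "(nat \<Rightarrow> nat) \<Rightarrow> nat"
  assumes "shape \<mu>"
  shows "(\<Sum>g\<in>vertical_strips \<mu> k. \<Sum>\<rho>\<in>horizontal_strips g (Suc c). w \<rho>)
    = (\<Sum>g\<in>horizontal_strips \<mu> (Suc c). \<Sum>\<rho>\<in>vertical_strips g k. w \<rho>)
    + (if k = 0 then 0 else \<Sum>g\<in>horizontal_strips \<mu> c. \<Sum>\<rho>\<in>vertical_strips g (k - 1). w \<rho>)"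
proof -
  let ?A = "vertical_strips \<mu> k" and ?B = "horizontal_strips \<mu> (Suc c)" and ?C = "horizontal_strips \<mu> c"
  define U where "U = (\<Union>g\<in>?A. horizontal_strips g (Suc c)) \<union> (\<Union>g\<in>?B. vertical_strips g k)
    \<union> (\<Union>g\<in>?C. vertical_strips g (k - 1))"
  have shapes: "shape g" if "g \<in> ?A \<or> g \<in> ?B \<or> g \<in> ?C" for g
    using that by (auto simp: vertical_strips_def horizontal_strips_def)
  have fin: "finite ?A" "finite ?B" "finite ?C"
    using assms by (auto intro!: finite_vertical_strips finite_horizontal_strips simp: shape_def)
  then have U: "finite U"
    using shapes unfolding U_def
    by (auto intro!: finite_vertical_strips finite_horizontal_strips simp: shape_def)
  have shapeU: "shape \<rho>" if "\<rho> \<in> U" for \<rho>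
    using that by (auto simp: U_def vertical_strips_def horizontal_strips_def)
  have "(\<Sum>g\<in>?A. \<Sum>\<rho>\<in>horizontal_strips g (Suc c). w \<rho>)
      = (\<Sum>\<rho>\<in>U. card {g \<in> ?A. \<rho> \<in> horizontal_strips g (Suc c)} * w \<rho>)"
    by (intro sum_double_count fin U) (auto simp: U_def)
  also have "\<dots> = (\<Sum>\<rho>\<in>U. card {g \<in> ?B. \<rho> \<in> vertical_strips g k} * w \<rho>
      + (if k = 0 then 0 else card {g \<in> ?C. \<rho> \<in> vertical_strips g (k - 1)} * w \<rho>))"
    by (intro sum.cong refl, subst card_strips_commute[OF assms shapeU]) (auto simp: algebra_simps)
  also have "\<dots> = (\<Sum>\<rho>\<in>U. card {g \<in> ?B. \<rho> \<in> vertical_strips g k} * w \<rho>)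
      + (if k = 0 then 0 else \<Sum>\<rho>\<in>U. card {g \<in> ?C. \<rho> \<in> vertical_strips g (k - 1)} * w \<rho>)"
    by (simp add: sum.distrib)
  also have "(\<Sum>\<rho>\<in>U. card {g \<in> ?B. \<rho> \<in> vertical_strips g k} * w \<rho>)
      = (\<Sum>g\<in>?B. \<Sum>\<rho>\<in>vertical_strips g k. w \<rho>)"
    by (intro sum_double_count[symmetric] fin U) (auto simp: U_def)
  also have "(\<Sum>\<rho>\<in>U. card {g \<in> ?C. \<rho> \<in> vertical_strips g (k - 1)} * w \<rho>)
      = (\<Sum>g\<in>?C. \<Sum>\<rho>\<in>vertical_strips g (k - 1). w \<rho>)"
    by (intro sum_double_count[symmetric] fin U) (auto simp: U_def)
  finally show ?thesis .
qed

lemma vertical_strips_0: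
  assumes "shape f"
  shows "vertical_strips f 0 = {f}"
proof -
  have "g = f" if g: "g \<in> vertical_strips f 0" for g
  proof
    fix i
    show "g i = f i"
    proof (rule ccontr)
      assume "g i \<noteq> f i"
      then have "f i < g i" using g by (auto simp: vertical_strips_def order.not_eq_order_implies_strict)
      then have "f j + of_bool (j \<in> {i}) \<le> g j" for j
        using g by (auto simp: vertical_strips_def)
      then have "shape_size (\<lambda>j. f j + of_bool (j \<in> {i})) \<le> shape_size g"
        using g by (intro shape_size_mono) (auto simp: vertical_strips_def shape_def)
      then show False
        using shape_size_add_indicator[of f "{i}"] g assms by (simp add: vertical_strips_def shape_def)
    qed
  qed
  moreover have "f \<in> vertical_strips f 0" using assms by (simp add: vertical_strips_def)
  ultimately show ?thesis by blast
qed

lemma subsets_insert_card: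
  assumes "finite S" "a \<notin> S"
  shows "{A. A \<subseteq> insert a S \<and> card A = k} = {A. A \<subseteq> S \<and> card A = k}
    \<union> (if k = 0 then {} else insert a ` {A. A \<subseteq> S \<and> card A = k - 1})" (is "?L = ?R")
proof (intro equalityI subsetI)
  fix A assume A: "A \<in> ?L"
  show "A \<in> ?R"
  proof (cases "a \<in> A")
    case True
    have "finite A" using A assms(1) by (auto intro: finite_subset)
    then have "A = insert a (A - {a})" "card (A - {a}) = k - 1" "k \<noteq> 0"
      using True A by (auto simp: card_gt_0_iff)
    then show ?thesis using A by (auto intro!: image_eqI[of _ _ "A - {a}"])
  qed (use A in auto)
next
  fix A assume A: "A \<in> ?R"
  have "card (insert a B) = Suc (card B)" if "B \<subseteq> S" for B
    using assms that finite_subset[OF that] by (intro card_insert_disjoint) auto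
  then show "A \<in> ?L"
    using A by (auto split: if_splits)
qed

text \<open>A set \<open>A\<close> without \<open>a\<close> leaves all \<open>Suc c\<close> copies
  of the largest entry, one with \<open>a\<close> leaves \<open>c\<close> copies and takes k - 1
  elements of \<open>M\<close>. Removing the remaining copies from the tableaux and applying the
  induction hypothesis to the smaller shapes gives the two terms of
  \<open>sum_strips_commute\<close>.\<close>

lemma pieri_tableau_count:
  assumes "shape f"
  shows "(\<Sum>A | A \<subseteq> set_mset M \<and> card A = k. tableau_count f (M - mset_set A))
    = (\<Sum>g\<in>vertical_strips f k. tableau_count g M)"
  using assms
proof (induction M arbitrary: f k rule: multiset_remove_largest_induct)
  case empty
  show ?case
  proof (cases "k = 0")
    case True
    have "{A :: nat set. A \<subseteq> set_mset {#} \<and> card A = k} = {{}}" using True by auto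
    then show ?thesis using vertical_strips_0[OF empty] True by simp
  next
    case False
    have "{A :: nat set. A \<subseteq> set_mset {#} \<and> card A = k} = {}" using False by auto
    moreover have "tableau_count g {#} = 0" if "g \<in> vertical_strips f k" for g
      using that False by (intro tableau_count_empty) (auto simp: vertical_strips_def shape_def)
    ultimately show ?thesis by (simp only: sum.empty) simp
  qed
next
  case (add M a c)
  let ?M = "M + replicate_mset (Suc c) a"
  let ?P = "\<lambda>k. {A. A \<subseteq> set_mset M \<and> card A = k}"
  have a: "a \<notin># M" using add(1) by blast
  have fin: "finite A" if "A \<subseteq> set_mset M" for A
    using that by (rule finite_subset) simp
  have minus: "x < a" if "x \<in># M - mset_set A" for x A
    using add(1) that by (blast dest: in_diffD)
  \<comment> \<open>General in both parameters: it is applied to \<open>k\<close> and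
    \<open>Suc c\<close> for the sets avoiding \<open>a\<close>, and to \<open>k - 1\<close> and
    \<open>c\<close> for the others.\<close>
  have step: "(\<Sum>A\<in>?P k. tableau_count f (M - mset_set A + replicate_mset c a))
      = (\<Sum>g\<in>horizontal_strips f c. \<Sum>h\<in>vertical_strips g k. tableau_count h M)" for k c
  proof -
    have "(\<Sum>A\<in>?P k. tableau_count f (M - mset_set A + replicate_mset c a))
        = (\<Sum>A\<in>?P k. \<Sum>g\<in>horizontal_strips f c. tableau_count g (M - mset_set A))"
      by (intro sum.cong refl tableau_count_remove_largest[OF add(3)] minus)
    also have "\<dots> = (\<Sum>g\<in>horizontal_strips f c. \<Sum>A\<in>?P k. tableau_count g (M - mset_set A))"
      by (rule sum.swap)
    also have "\<dots> = (\<Sum>g\<in>horizontal_strips f c. \<Sum>h\<in>vertical_strips g k. tableau_count h M)"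
      by (intro sum.cong refl add(2)) (simp add: horizontal_strips_def)
    finally show ?thesis .
  qed
  have 1: "?M - mset_set A = M - mset_set A + replicate_mset (Suc c) a" if "A \<subseteq> set_mset M" for A
    using that a fin[OF that] by (intro multiset_eqI) (auto simp: count_mset_set')
  have 2: "?M - mset_set (insert a A) = M - mset_set A + replicate_mset c a" if "A \<subseteq> set_mset M" for A
    using that a fin[OF that] by (intro multiset_eqI) (auto simp: count_mset_set')
  have inj: "inj_on (insert a) (?P k)" for k
    using a by (auto simp: inj_on_def)
  have "set_mset ?M = insert a (set_mset M)" by auto
  then have "(\<Sum>A | A \<subseteq> set_mset ?M \<and> card A = k. tableau_count f (?M - mset_set A))
      = (\<Sum>A\<in>?P k \<union> (if k = 0 then {} else insert a ` ?P (k - 1)). tableau_count f (?M - mset_set A))"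
    by (simp only: subsets_insert_card[OF finite_set_mset a])
  also have "\<dots> = (\<Sum>A\<in>?P k. tableau_count f (?M - mset_set A))
      + (if k = 0 then 0 else \<Sum>A\<in>insert a ` ?P (k - 1). tableau_count f (?M - mset_set A))"
    using a by (auto intro!: sum.union_disjoint)
  also have "(\<Sum>A\<in>insert a ` ?P (k - 1). tableau_count f (?M - mset_set A))
      = (\<Sum>A\<in>?P (k - 1). tableau_count f (M - mset_set A + replicate_mset c a))"
    unfolding sum.reindex[OF inj] comp_def by (intro sum.cong refl) (simp only: 2 mem_Collect_eq)
  also have "(\<Sum>A\<in>?P k. tableau_count f (?M - mset_set A))
      = (\<Sum>A\<in>?P k. tableau_count f (M - mset_set A + replicate_mset (Suc c) a))"
    by (intro sum.cong refl) (simp only: 1 mem_Collect_eq)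
  also have "(\<Sum>A\<in>?P k. tableau_count f (M - mset_set A + replicate_mset (Suc c) a))
      + (if k = 0 then 0 else \<Sum>A\<in>?P (k - 1). tableau_count f (M - mset_set A + replicate_mset c a))
      = (\<Sum>g\<in>vertical_strips f k. \<Sum>h\<in>horizontal_strips g (Suc c). tableau_count h M)"
    unfolding step by (rule sum_strips_commute[OF add(3), symmetric])
  also have "\<dots> = (\<Sum>g\<in>vertical_strips f k. tableau_count g ?M)"
    by (intro sum.cong refl tableau_count_remove_largest[symmetric] add(1))
      (simp_all add: vertical_strips_def)
  finally show ?case .
qed

section \<open>Schur positivity\<close>

definition rows :: "nat list \<Rightarrow> nat \<Rightarrow> nat" where
  "rows p i = (if i < length p then p ! i else 0)"

lemma schur_eq_tableau_count: "schur p M = of_nat (tableau_count (rows p) M)"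
proof -
  have "young_diagram p = diagram (rows p)"
    by (auto simp: young_diagram_def diagram_def rows_def split: if_splits)
  then show ?thesis
    by (simp add: schur_def monomial_sum_def tableau_count_def semistandard_tableaux_def
        tableaux_def content_def del: diagram_iff)
qed

lemma shape_rows:
  assumes "is_partition p"
  shows "shape (rows p)"
proof -
  have "rows p (Suc i) \<le> rows p i" for i
    using assms by (auto simp: is_partition_def rows_def sorted_wrt_iff_nth_less)
  moreover have "finite_support (rows p)"
    by (intro finite_supportI[of "length p"]) (simp add: rows_def)
  ultimately show ?thesis by (simp add: shape_def antimono_iff_le_Suc)
qed

lemma ex_partition_rows:
  assumes "shape f"
  obtains p where "is_partition p" "rows p = f"
proof
  obtain R0 where "f R0 = 0"
    using assms finite_support_bound unfolding shape_def by blast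
  \<comment> \<open>The least empty row: all earlier rows are nonzero, as the parts of a partition
    must be, and all later ones vanish by monotonicity.\<close>
  define R where "R = (LEAST i. f i = 0)"
  have R: "f R = 0" unfolding R_def using \<open>f R0 = 0\<close> by (rule LeastI)
  have anti: "f j \<le> f i" if "i \<le> j" for i j
    using assms that by (auto simp: shape_def antimono_def)
  show "is_partition (map f [0..<R])"
    using anti not_less_Least[of _ "\<lambda>i. f i = 0", folded R_def]
    by (force simp: is_partition_def sorted_wrt_iff_nth_less)
  show "rows (map f [0..<R]) = f"
  proof
    fix i show "rows (map f [0..<R]) i = f i"
      using anti[of R i] R by (simp add: rows_def)
  qed
qed

text \<open>The Pieri expansion has one Schur function, with coefficient 1, for each vertical
  strip.\<close>

lemma schur_positive_series_mult_elementary: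
  assumes "schur_positive f"
  shows "schur_positive (series_mult (elementary k) f)"
  using assms unfolding schur_positive_def
proof (rule nonneg_combination_linear_image)
  fix p assume p: "is_partition p"
  have "series_mult (elementary k) (schur p) M
      = (\<Sum>g\<in>vertical_strips (rows p) k. of_nat (tableau_count g M))" for M
    unfolding series_mult_elementary schur_eq_tableau_count
    using pieri_tableau_count[OF shape_rows[OF p], of M k] by (simp flip: of_nat_sum)
  then have "series_mult (elementary k) (schur p)
      = (\<lambda>M. \<Sum>g\<in>vertical_strips (rows p) k. of_nat (tableau_count g M))" by blast
  moreover have "nonneg_combination schur (\<lambda>M. of_nat (tableau_count g M))"
    if "g \<in> vertical_strips (rows p) k" for g
  proof -
    have "shape g" using that by (simp add: vertical_strips_def)
    then obtain q where "is_partition q" "rows q = g" by (rule ex_partition_rows)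
    then show ?thesis
      using nonneg_combination_basis[of q schur] by (simp add: schur_eq_tableau_count[abs_def])
  qed
  ultimately show "nonneg_combination schur (series_mult (elementary k) (schur p))"
    by (simp add: nonneg_combination_sum)
qed (rule series_mult_sum_right)

lemma schur_positive_elementary_partition: "schur_positive (elementary_partition p)"
proof (induction p)
  case Nil
  \<comment> \<open>The empty diagram has a single filling, of empty content, so its Schur function
    is 1.\<close>
  have "semistandard_tableaux [] = {\<lambda>_. undefined}" "young_diagram [] = {}"
    by (auto simp: semistandard_tableaux_def young_diagram_def)
  then have "elementary_partition [] = schur []"
    by (auto simp add: elementary_partition_def series_one_def schur_def monomial_sum_def intro!: ext)
  then show ?case
    unfolding schur_positive_def by (auto intro: nonneg_combination_basis simp: is_partition_def)
next
  case (Cons k p)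
  then show ?case
    unfolding elementary_partition_Cons by (rule schur_positive_series_mult_elementary)
qed

lemma e_positive_imp_schur_positive:
  assumes "e_positive f"
  shows "schur_positive f"
  unfolding schur_positive_def
  using assms[unfolded e_positive_def]
  by (rule nonneg_combination_linear_image[where F = "\<lambda>f. f"])
    (auto intro: schur_positive_elementary_partition[unfolded schur_positive_def])

theorem theorem3p3:
  fixes m n :: nat
  shows "e_positive (chromatic_symmetric_function (lollipop m n)) \<and>
         schur_positive (chromatic_symmetric_function (lollipop m n))"
  unfolding chromatic_symmetric_function_lollipop
  by (intro conjI e_positive_imp_schur_positive e_positive_lollipop_series)

end
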